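(* An $\omega$-saturated linearly ordered structure satisfies condition (RB) if and only if it is definitionally equivalent to a colored order.
   Context: A linearly ordered structure is a first-order structure $(M,<,\dots)$ in a language containing $<$, interpreted as a linear order. A colored order is a linear order expanded by unary predicates only. Two structures are definitionally equivalent if they have the same domain and the same definable sets of tuples. Given a sequence $(\phi_1(x),\dots,\phi_n(x))$ of formulae in one free variable and elements $a<b$, the sequence is realized between $a$ and $b$ if there are $c_1,\dots,c_n$ with $a<c_1<\dots<c_n<b$ and $c_i$ satisfying $\phi_i$. A structure satisfies (RB) if, with $T$ its complete theory: two increasing $n$-tuples $a_1<\dots<a_n$ and $b_1<\dots<b_n$ of elements of models of $T$ have the same type if and only if $\mathrm{tp}(a_i)=\mathrm{tp}(b_i)$ for every $i\le n$ and, for every $i<n$, the same finite sequences of formulae are realized between $a_i$ and $a_{i+1}$ as between $b_i$ and $b_{i+1}$.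
   Formalization: The colored order is required to have the same order < as the given linearly ordered structure; if a different order on the same domain were allowed, a structure definitionally equivalent to a colored order could fail (RB). *)

theory Defs
  imports Main "HOL-Library.Equipollence"
begin

section \<open>First-order logic with equality\<close>

text \<open>A symbol is a name together with an arity, so a language is a set of function symbols and a
  set of relation symbols; the same name at two arities gives two different symbols, and constants
  are function symbols of arity 0.\<close>

record ('f, 'r) lang =
  funs :: "('f \<times> nat) set"
  rels :: "('r \<times> nat) set"

text \<open>Variables are de Bruijn indices: \<open>Exi\<close> binds index 0 and shifts the other indices by one.\<close>

datatype 'f tm = Var nat | Fn 'f "'f tm list"

datatype ('f, 'r) fm =
    Eq "'f tm" "'f tm"
  | Rel 'r "'f tm list"
  | Neg "('f, 'r) fm"
  | Conj "('f, 'r) fm" "('f, 'r) fm"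
  | Exi "('f, 'r) fm"

primrec wf_tm :: "('f, 'r) lang \<Rightarrow> 'f tm \<Rightarrow> bool" where
  "wf_tm L (Var n) \<longleftrightarrow> True"
| "wf_tm L (Fn f ts) \<longleftrightarrow> (f, length ts) \<in> funs L \<and> list_all (wf_tm L) ts"

primrec wf_fm :: "('f, 'r) lang \<Rightarrow> ('f, 'r) fm \<Rightarrow> bool" where
  "wf_fm L (Eq t u) \<longleftrightarrow> wf_tm L t \<and> wf_tm L u"
| "wf_fm L (Rel r ts) \<longleftrightarrow> (r, length ts) \<in> rels L \<and> list_all (wf_tm L) ts"
| "wf_fm L (Neg \<phi>) \<longleftrightarrow> wf_fm L \<phi>"
| "wf_fm L (Conj \<phi> \<psi>) \<longleftrightarrow> wf_fm L \<phi> \<and> wf_fm L \<psi>"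
| "wf_fm L (Exi \<phi>) \<longleftrightarrow> wf_fm L \<phi>"

primrec fv_tm :: "'f tm \<Rightarrow> nat set" where
  "fv_tm (Var n) = {n}"
| "fv_tm (Fn f ts) = \<Union>(set (map fv_tm ts))"

primrec fv :: "('f, 'r) fm \<Rightarrow> nat set" where
  "fv (Eq t u) = fv_tm t \<union> fv_tm u"
| "fv (Rel r ts) = (\<Union>t\<in>set ts. fv_tm t)"
| "fv (Neg \<phi>) = fv \<phi>"
| "fv (Conj \<phi> \<psi>) = fv \<phi> \<union> fv \<psi>"
| "fv (Exi \<phi>) = {n. Suc n \<in> fv \<phi>}"

definition formulas :: "('f, 'r) lang \<Rightarrow> nat \<Rightarrow> ('f, 'r) fm set" where
  "formulas L n = {\<phi>. wf_fm L \<phi> \<and> fv \<phi> \<subseteq> {..<n}}"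

record ('f, 'r, 'a) struct =
  universe :: "'a set"
  fnI :: "'f \<Rightarrow> 'a list \<Rightarrow> 'a"
  relI :: "'r \<Rightarrow> 'a list \<Rightarrow> bool"

definition is_struct :: "('f, 'r) lang \<Rightarrow> ('f, 'r, 'a) struct \<Rightarrow> bool" where
  "is_struct L M \<longleftrightarrow> universe M \<noteq> {} \<and>
    (\<forall>(f, n) \<in> funs L. \<forall>xs. length xs = n \<longrightarrow> set xs \<subseteq> universe M \<longrightarrow> fnI M f xs \<in> universe M)"

primrec eval :: "('f, 'r, 'a) struct \<Rightarrow> (nat \<Rightarrow> 'a) \<Rightarrow> 'f tm \<Rightarrow> 'a" where
  "eval M s (Var n) = s n"
| "eval M s (Fn f ts) = fnI M f (map (eval M s) ts)"

primrec sat :: "('f, 'r, 'a) struct \<Rightarrow> (nat \<Rightarrow> 'a) \<Rightarrow> ('f, 'r) fm \<Rightarrow> bool" where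
  "sat M s (Eq t u) \<longleftrightarrow> eval M s t = eval M s u"
| "sat M s (Rel r ts) \<longleftrightarrow> relI M r (map (eval M s) ts)"
| "sat M s (Neg \<phi>) \<longleftrightarrow> \<not> sat M s \<phi>"
| "sat M s (Conj \<phi> \<psi>) \<longleftrightarrow> sat M s \<phi> \<and> sat M s \<psi>"
| "sat M s (Exi \<phi>) \<longleftrightarrow> (\<exists>a \<in> universe M. sat M (case_nat a s) \<phi>)"

text \<open>\<open>holds M xs \<phi>\<close> is only used when all free variables of \<open>\<phi>\<close> are below \<open>length xs\<close>.\<close>

definition holds :: "('f, 'r, 'a) struct \<Rightarrow> 'a list \<Rightarrow> ('f, 'r) fm \<Rightarrow> bool" where
  "holds M xs \<phi> \<longleftrightarrow> sat M (\<lambda>i. xs ! i) \<phi>"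

section \<open>Types, theories, saturation, definable sets\<close>

definition tp :: "('f, 'r) lang \<Rightarrow> ('f, 'r, 'a) struct \<Rightarrow> 'a list \<Rightarrow> ('f, 'r) fm set" where
  "tp L M xs = {\<phi> \<in> formulas L (length xs). holds M xs \<phi>}"

definition complete_theory :: "('f, 'r) lang \<Rightarrow> ('f, 'r, 'a) struct \<Rightarrow> ('f, 'r) fm set" where
  "complete_theory L M = {\<phi> \<in> formulas L 0. holds M [] \<phi>}"

definition is_model :: "('f, 'r) lang \<Rightarrow> ('f, 'r) fm set \<Rightarrow> ('f, 'r, 'a) struct \<Rightarrow> bool" where
  "is_model L T N \<longleftrightarrow> is_struct L N \<and> (\<forall>\<phi> \<in> T. holds N [] \<phi>)"

text \<open>Every set of formulas in one variable over a finite tuple of parameters that is finitely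
  satisfiable in \<open>M\<close> is realized in \<open>M\<close>; index 0 is the variable, the later indices stand for the
  parameters.\<close>

definition omega_saturated :: "('f, 'r) lang \<Rightarrow> ('f, 'r, 'a) struct \<Rightarrow> bool" where
  "omega_saturated L M \<longleftrightarrow>
    (\<forall>as \<Phi>. set as \<subseteq> universe M \<longrightarrow> \<Phi> \<subseteq> formulas L (Suc (length as)) \<longrightarrow>
      (\<forall>\<Psi> \<subseteq> \<Phi>. finite \<Psi> \<longrightarrow> (\<exists>c \<in> universe M. \<forall>\<phi> \<in> \<Psi>. holds M (c # as) \<phi>)) \<longrightarrow>
      (\<exists>c \<in> universe M. \<forall>\<phi> \<in> \<Phi>. holds M (c # as) \<phi>))"

text \<open>Definability is without parameters.\<close>

definition definable :: "('f, 'r) lang \<Rightarrow> ('f, 'r, 'a) struct \<Rightarrow> nat \<Rightarrow> 'a list set \<Rightarrow> bool" where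
  "definable L M n X \<longleftrightarrow>
    (\<exists>\<phi> \<in> formulas L n. X = {xs. length xs = n \<and> set xs \<subseteq> universe M \<and> holds M xs \<phi>})"

definition definitionally_equivalent ::
  "('f, 'r) lang \<Rightarrow> ('f, 'r, 'a) struct \<Rightarrow> ('g, 'q) lang \<Rightarrow> ('g, 'q, 'a) struct \<Rightarrow> bool" where
  "definitionally_equivalent L M L' N \<longleftrightarrow>
    universe M = universe N \<and> (\<forall>n X. definable L M n X \<longleftrightarrow> definable L' N n X)"

section \<open>Linearly ordered structures\<close>

definition less_in :: "'r \<Rightarrow> ('f, 'r, 'a) struct \<Rightarrow> 'a \<Rightarrow> 'a \<Rightarrow> bool" where
  "less_in lt M x y \<longleftrightarrow> relI M lt [x, y]"

definition linearly_ordered :: "('f, 'r) lang \<Rightarrow> 'r \<Rightarrow> ('f, 'r, 'a) struct \<Rightarrow> bool" where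
  "linearly_ordered L lt M \<longleftrightarrow> is_struct L M \<and> (lt, 2) \<in> rels L \<and>
    irreflp_on (universe M) (less_in lt M) \<and>
    transp_on (universe M) (less_in lt M) \<and>
    totalp_on (universe M) (less_in lt M)"

definition colored_order :: "('f, 'r) lang \<Rightarrow> 'r \<Rightarrow> ('f, 'r, 'a) struct \<Rightarrow> bool" where
  "colored_order L lt M \<longleftrightarrow> linearly_ordered L lt M \<and>
    funs L = {} \<and> rels L \<subseteq> insert (lt, 2) {(P, 1) |P. True}"

definition increasing :: "'r \<Rightarrow> ('f, 'r, 'a) struct \<Rightarrow> 'a list \<Rightarrow> bool" where
  "increasing lt M xs \<longleftrightarrow> set xs \<subseteq> universe M \<and> sorted_wrt (less_in lt M) xs"

definition realized_between ::
  "'r \<Rightarrow> ('f, 'r, 'a) struct \<Rightarrow> 'a \<Rightarrow> 'a \<Rightarrow> ('f, 'r) fm list \<Rightarrow> bool" where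
  "realized_between lt M a b \<phi>s \<longleftrightarrow>
    (\<exists>cs. increasing lt M (a # cs @ [b]) \<and> list_all2 (\<lambda>c \<phi>. holds M [c] \<phi>) cs \<phi>s)"

text \<open>The two tuples may come from different models. HOL cannot quantify over all models inside a
  formula, so the models range over all structures whose universe is a set of elements of a type
  \<open>'u\<close>. Once \<open>'u\<close> is at least as large as the set of \<open>L\<close>-formulas this is no restriction: by
  Loewenheim-Skolem every tuple of a model of \<open>T\<close> lies in an elementary submodel of at most
  that size.\<close>

definition RB ::
  "'u itself \<Rightarrow> ('f, 'r) lang \<Rightarrow> 'r \<Rightarrow> ('f, 'r, 'a) struct \<Rightarrow> bool" where
  "RB U L lt M \<longleftrightarrow>
    (\<forall>(N :: ('f, 'r, 'u) struct) (N' :: ('f, 'r, 'u) struct) as bs.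
      is_model L (complete_theory L M) N \<longrightarrow> is_model L (complete_theory L M) N' \<longrightarrow>
      increasing lt N as \<longrightarrow> increasing lt N' bs \<longrightarrow> length as = length bs \<longrightarrow>
      (tp L N as = tp L N' bs \<longleftrightarrow>
        (\<forall>i < length as. tp L N [as ! i] = tp L N' [bs ! i]) \<and>
        (\<forall>i. Suc i < length as \<longrightarrow>
          (\<forall>\<phi>s. set \<phi>s \<subseteq> formulas L 1 \<longrightarrow>
            (realized_between lt N (as ! i) (as ! Suc i) \<phi>s \<longleftrightarrow>
             realized_between lt N' (bs ! i) (bs ! Suc i) \<phi>s)))))"

text \<open>The colored order has the same order as \<open>M\<close>: \<open><\<close> is part of a linearly ordered structure,
  and for another order on the same universe the condition would not imply \<open>RB\<close>. Color names are
  taken from the type \<open>'a set\<close>, which provides a name for every possible color; two colors with the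
  same extension define the same sets.\<close>

definition def_equiv_to_colored_order ::
  "('f, 'r) lang \<Rightarrow> 'r \<Rightarrow> ('f, 'r, 'a) struct \<Rightarrow> bool" where
  "def_equiv_to_colored_order L lt M \<longleftrightarrow>
    (\<exists>(K :: (unit, 'a set) lang) lt' (C :: (unit, 'a set, 'a) struct).
      colored_order K lt' C \<and>
      (\<forall>x \<in> universe M. \<forall>y \<in> universe M. less_in lt' C x y \<longleftrightarrow> less_in lt M x y) \<and>
      definitionally_equivalent L M K C)"

end

theory Submission
  imports Defs
begin

text \<open>Write \<open>S a b\<close> for the set of sequences realized between \<open>a\<close> and \<open>b\<close>. By saturation and
  Loewenheim-Skolem, \<open>RB\<close> may be tested on tuples of \<open>M\<close> alone. In every \<open>\<omega>\<close>-saturated linearly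
  ordered structure, the relation "same order, same 1-types and same \<open>S\<close> for all pairs" between
  tuples has the back-and-forth property, so related tuples satisfy the same formulas built from the
  order and unary predicates. This gives \<open>RB\<close> for structures equivalent to a colored order.
  Conversely, color \<open>M\<close> by all its definable unary sets. Tuples that agree on all formulas of the
  colored order are related, since realizing a sequence between two points is such a formula. Under
  \<open>RB\<close> they have the same type, and compactness makes every formula equivalent to one of these.\<close>

section \<open>Formulas\<close>

text \<open>The obstacle is a new point \<open>c\<close> between \<open>x\<close> and
  \<open>y\<close>. Over one endpoint, equality of types and saturation copy \<open>c\<close>
  exactly. Over both endpoints only the 1-types and \<open>S x y\<close> are known to agree, so the
  type of the pair (\<open>x\<close>, \<open>y\<close>) may differ from that of (\<open>x'\<close>,
  \<open>y'\<close>). Saturation over both can then ask only for what realized sequences guarantee,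
  and this gives inclusions between the sets, not equalities. Reaching equality on both sides at
  once is the core of the proof. The empty sequence lies in \<open>S a b\<close> exactly when
  \<open>a\<close> is below \<open>b\<close>, so these sets also carry the order; and
  \<open>S x y\<close> is determined by the two parts and the 1-type at any intermediate point. This
  links the condition on neighbours in \<open>RB\<close> to the relation on all pairs. Two gaps have
  to be bridged. \<open>RB\<close> speaks of structures over \<open>'u\<close> while
  \<open>M\<close> lives on \<open>'a\<close>: small elementary submodels lead from \<open>M\<close>
  to \<open>'u\<close>, extension of types leads back. And saturation concerns one variable over
  finitely many parameters, while the compactness argument concerns pairs of n-tuples: the variables
  are quantified away one at a time.\<close>

lemma eval_cong: "(\<And>n. n \<in> fv_tm t \<Longrightarrow> s n = s' n) \<Longrightarrow> eval M s t = eval M s' t"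
proof (induction t)
  case (Fn f ts)
  then have "map (eval M s) ts = map (eval M s') ts"
    by (intro map_cong refl Fn.IH) auto
  then show ?case by (simp del: map_eq_conv)
qed simp

lemma sat_cong: "(\<And>n. n \<in> fv \<phi> \<Longrightarrow> s n = s' n) \<Longrightarrow> sat M s \<phi> = sat M s' \<phi>"
proof (induction \<phi> arbitrary: s s')
  case (Eq t u)
  then show ?case by (simp add: eval_cong[of t s s'] eval_cong[of u s s'])
next
  case (Rel r ts)
  then have "map (eval M s) ts = map (eval M s') ts"
    by (auto intro!: eval_cong)
  then show ?case by (simp del: map_eq_conv)
next
  case (Neg \<phi>)
  then show ?case by (metis sat.simps(3) fv.simps(3))
next
  case (Conj \<phi> \<psi>)
  then show ?case by (metis Un_iff sat.simps(4) fv.simps(4))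
next
  case (Exi \<phi>)
  have "sat M (case_nat a s) \<phi> = sat M (case_nat a s') \<phi>" for a
    using Exi.prems by (intro Exi.IH) (auto split: nat.split)
  then show ?case by simp
qed

text \<open>\<open>holds\<close> turns a list into an infinite assignment whose values past the end
  carry no information. A formula in \<open>formulas L n\<close> reads only the first
  \<open>n\<close> values, so any assignment agreeing there will do.\<close>

lemma sat_eq_holds:
  "\<phi> \<in> formulas L n \<Longrightarrow> (\<And>i. i < n \<Longrightarrow> s i = xs ! i) \<Longrightarrow> sat M s \<phi> = holds M xs \<phi>"
  unfolding holds_def formulas_def by (intro sat_cong) auto

lemma finite_fv_tm: "finite (fv_tm t)"
  by (induction t) auto

lemma finite_fv: "finite (fv \<phi>)"
proof (induction \<phi>)
  case (Exi \<phi>)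
  have "{n. Suc n \<in> fv \<phi>} = Suc -` fv \<phi>" by auto
  then show ?case by (simp add: Exi.IH finite_vimageI)
qed (auto simp: finite_fv_tm)

lemma Neg_in_formulas [simp]: "Neg \<phi> \<in> formulas L n \<longleftrightarrow> \<phi> \<in> formulas L n"
  by (auto simp: formulas_def)

lemma Conj_in_formulas [simp]:
  "Conj \<phi> \<psi> \<in> formulas L n \<longleftrightarrow> \<phi> \<in> formulas L n \<and> \<psi> \<in> formulas L n"
  by (auto simp: formulas_def)

lemma Exi_in_formulas [simp]: "Exi \<phi> \<in> formulas L n \<longleftrightarrow> \<phi> \<in> formulas L (Suc n)"
proof -
  have "{m. Suc m \<in> fv \<phi>} \<subseteq> {..<n} \<longleftrightarrow> fv \<phi> \<subseteq> {..<Suc n}"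
    by (auto simp: subset_iff less_Suc_eq_0_disj) (metis not0_implies_Suc)
  then show ?thesis by (simp add: formulas_def)
qed

lemma Eq_in_formulas [simp]: "Eq (Var i) (Var j) \<in> formulas L n \<longleftrightarrow> i < n \<and> j < n"
  by (auto simp: formulas_def)

lemma Rel1_in_formulas [simp]: "Rel r [Var i] \<in> formulas L n \<longleftrightarrow> (r, 1) \<in> rels L \<and> i < n"
  by (auto simp: formulas_def)

lemma Rel2_in_formulas [simp]:
  "Rel r [Var i, Var j] \<in> formulas L n \<longleftrightarrow> (r, 2) \<in> rels L \<and> i < n \<and> j < n"
  by (auto simp: formulas_def numeral_2_eq_2)

lemma formulas_mono: "\<phi> \<in> formulas L m \<Longrightarrow> m \<le> n \<Longrightarrow> \<phi> \<in> formulas L n"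
  by (force simp: formulas_def)

lemma holds_Eq [simp]: "holds M xs (Eq (Var i) (Var j)) \<longleftrightarrow> xs ! i = xs ! j"
  by (simp add: holds_def)

lemma holds_Rel1 [simp]: "holds M xs (Rel r [Var i]) \<longleftrightarrow> relI M r [xs ! i]"
  by (simp add: holds_def)

lemma holds_Rel2 [simp]: "holds M xs (Rel r [Var i, Var j]) \<longleftrightarrow> less_in r M (xs ! i) (xs ! j)"
  by (simp add: holds_def less_in_def)

lemma holds_Neg [simp]: "holds M xs (Neg \<phi>) \<longleftrightarrow> \<not> holds M xs \<phi>"
  by (simp add: holds_def)

lemma holds_Conj [simp]: "holds M xs (Conj \<phi> \<psi>) \<longleftrightarrow> holds M xs \<phi> \<and> holds M xs \<psi>"
  by (simp add: holds_def)

lemma holds_Exi [simp]: "holds M xs (Exi \<phi>) \<longleftrightarrow> (\<exists>a\<in>universe M. holds M (a # xs) \<phi>)"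
proof -
  have "case_nat a (\<lambda>i. xs ! i) = (\<lambda>i. (a # xs) ! i)" for a
    by (rule ext) (simp add: nth_Cons split: nat.split)
  then show ?thesis by (simp add: holds_def)
qed

text \<open>The empty conjunction must be a sentence: \<open>Eq (Var 0) (Var 0)\<close> has a free
  variable and would not belong to \<open>formulas L 0\<close>.\<close>

primrec conjs :: "('f, 'r) fm list \<Rightarrow> ('f, 'r) fm" where
  "conjs [] = Neg (Exi (Neg (Eq (Var 0) (Var 0))))"
| "conjs (\<phi> # \<phi>s) = Conj \<phi> (conjs \<phi>s)"

lemma conjs_in_formulas [simp]: "conjs \<phi>s \<in> formulas L n \<longleftrightarrow> set \<phi>s \<subseteq> formulas L n"
  by (induction \<phi>s) auto

lemma holds_conjs [simp]: "holds M xs (conjs \<phi>s) \<longleftrightarrow> (\<forall>\<phi>\<in>set \<phi>s. holds M xs \<phi>)"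
  by (induction \<phi>s) auto

primrec rename_tm :: "(nat \<Rightarrow> nat) \<Rightarrow> 'f tm \<Rightarrow> 'f tm" where
  "rename_tm \<rho> (Var n) = Var (\<rho> n)"
| "rename_tm \<rho> (Fn f ts) = Fn f (map (rename_tm \<rho>) ts)"

primrec rename :: "(nat \<Rightarrow> nat) \<Rightarrow> ('f, 'r) fm \<Rightarrow> ('f, 'r) fm" where
  "rename \<rho> (Eq t u) = Eq (rename_tm \<rho> t) (rename_tm \<rho> u)"
| "rename \<rho> (Rel r ts) = Rel r (map (rename_tm \<rho>) ts)"
| "rename \<rho> (Neg \<phi>) = Neg (rename \<rho> \<phi>)"
| "rename \<rho> (Conj \<phi> \<psi>) = Conj (rename \<rho> \<phi>) (rename \<rho> \<psi>)"
| "rename \<rho> (Exi \<phi>) = Exi (rename (case_nat 0 (\<lambda>n. Suc (\<rho> n))) \<phi>)"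

lemma eval_rename: "eval M s (rename_tm \<rho> t) = eval M (\<lambda>i. s (\<rho> i)) t"
  by (induction t) (auto intro!: arg_cong[where f = "fnI M _"])

lemma sat_rename: "sat M s (rename \<rho> \<phi>) = sat M (\<lambda>i. s (\<rho> i)) \<phi>"
proof (induction \<phi> arbitrary: s \<rho>)
  case (Exi \<phi>)
  have "(\<lambda>i. case_nat a s (case_nat 0 (\<lambda>n. Suc (\<rho> n)) i)) = case_nat a (\<lambda>i. s (\<rho> i))" for a
    by (rule ext) (simp split: nat.split)
  then show ?case by (simp add: Exi.IH)
qed (simp_all add: eval_rename comp_def)

lemma fv_rename_tm: "fv_tm (rename_tm \<rho> t) = \<rho> ` fv_tm t"
  by (induction t) auto

lemma fv_rename: "fv (rename \<rho> \<phi>) \<subseteq> \<rho> ` fv \<phi>"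
proof (induction \<phi> arbitrary: \<rho>)
  case (Exi \<phi>)
  show ?case
  proof
    fix n assume "n \<in> fv (rename \<rho> (Exi \<phi>))"
    then have "Suc n \<in> case_nat 0 (\<lambda>n. Suc (\<rho> n)) ` fv \<phi>"
      using Exi.IH by auto
    then show "n \<in> \<rho> ` fv (Exi \<phi>)" by (auto split: nat.splits)
  qed
qed (fastforce simp: fv_rename_tm)+

lemma wf_rename_tm: "wf_tm L (rename_tm \<rho> t) = wf_tm L t"
  by (induction t) (auto simp: list_all_iff)

lemma wf_rename: "wf_fm L (rename \<rho> \<phi>) = wf_fm L \<phi>"
  by (induction \<phi> arbitrary: \<rho>) (auto simp: wf_rename_tm list_all_iff)

lemma rename_in_formulas:
  "\<phi> \<in> formulas L m \<Longrightarrow> (\<And>i. i < m \<Longrightarrow> \<rho> i < n) \<Longrightarrow> rename \<rho> \<phi> \<in> formulas L n"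
  using fv_rename[of \<rho> \<phi>] by (fastforce simp: formulas_def wf_rename)

lemma holds_rename:
  "\<phi> \<in> formulas L (length ys) \<Longrightarrow> (\<And>i. i < length ys \<Longrightarrow> xs ! \<rho> i = ys ! i) \<Longrightarrow>
    holds M xs (rename \<rho> \<phi>) = holds M ys \<phi>"
  by (simp add: holds_def[of M xs] sat_rename sat_eq_holds)

lemma in_tp_iff: "\<phi> \<in> formulas L (length xs) \<Longrightarrow> \<phi> \<in> tp L M xs \<longleftrightarrow> holds M xs \<phi>"
  by (simp add: tp_def)

lemma tp_eqI:
  assumes "length xs = length ys"
    and "\<And>\<phi>. \<phi> \<in> formulas L (length xs) \<Longrightarrow> holds M xs \<phi> = holds N ys \<phi>"
  shows "tp L M xs = tp L N ys"
  using assms by (auto simp: tp_def)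

lemma tp_eqD:
  assumes "tp L M xs = tp L N ys" "length xs = length ys" "\<phi> \<in> formulas L (length xs)"
  shows "holds M xs \<phi> = holds N ys \<phi>"
  using assms in_tp_iff by metis

text \<open>Renaming variables turns a formula about selected entries into one about the whole
  tuple. The list \<open>is\<close> may permute or repeat positions, so this yields types of single
  entries and of pairs in either order.\<close>

lemma tp_eq_sub:
  assumes eq: "tp L M xs = tp L N ys" and len: "length xs = length ys"
    and is_len: "\<And>i. i \<in> set is \<Longrightarrow> i < length xs"
  shows "tp L M (map ((!) xs) is) = tp L N (map ((!) ys) is)"
proof (rule tp_eqI)
  fix \<phi> :: "('a, 'b) fm"
  assume \<phi>: "\<phi> \<in> formulas L (length (map ((!) xs) is))"
  let ?\<phi> = "rename ((!) is) \<phi>"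
  have "?\<phi> \<in> formulas L (length xs)"
    using \<phi> is_len by (auto intro!: rename_in_formulas)
  then have "holds M xs ?\<phi> = holds N ys ?\<phi>"
    by (rule tp_eqD[OF eq len])
  moreover have "holds M xs ?\<phi> = holds M (map ((!) xs) is) \<phi>"
    using \<phi> by (intro holds_rename) auto
  moreover have "holds N ys ?\<phi> = holds N (map ((!) ys) is) \<phi>"
    using \<phi> by (intro holds_rename) auto
  ultimately show "holds M (map ((!) xs) is) \<phi> = holds N (map ((!) ys) is) \<phi>" by simp
qed simp

section \<open>Small elementary submodels\<close>

lemma lepoll_iff_ordLeq: "A \<lesssim> B \<longleftrightarrow> (card_of A, card_of B) \<in> ordLeq"
  by (simp add: lepoll_def card_of_ordLeq)

text \<open>For each length the lists inject into \<open>'u\<close>, because an infinite set absorbs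
  its square; all lists are then a countable union of such sets.\<close>

lemma lists_lepoll_infinite:
  assumes "infinite (UNIV :: 'u set)" "A \<lesssim> (UNIV :: 'u set)"
  shows "lists A \<lesssim> (UNIV :: 'u set)"
proof -
  let ?B = "\<lambda>n. {xs :: 'u list. length xs = n}"
  have B: "?B n \<lesssim> (UNIV :: 'u set)" for n
  proof (induction n)
    case 0
    show ?case by (simp add: lepoll_def)
  next
    case (Suc n)
    have "?B (Suc n) = (\<lambda>(x, xs). x # xs) ` (UNIV \<times> ?B n)"
      by (auto simp: length_Suc_conv image_iff)
    then have "?B (Suc n) \<lesssim> (UNIV :: 'u set) \<times> ?B n"
      by (metis image_lepoll)
    also have "\<dots> \<lesssim> (UNIV :: 'u set) \<times> (UNIV :: 'u set)"
      using Suc by (intro times_lepoll_mono) auto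
    also have "\<dots> \<lesssim> (UNIV :: 'u set)"
      using card_of_Times_same_infinite[OF assms(1)]
      by (simp add: lepoll_iff_ordLeq ordIso_imp_ordLeq)
    finally show ?case .
  qed
  have "lists A \<lesssim> lists (UNIV :: 'u set)"
    by (rule lists_lepoll_mono[OF assms(2)])
  also have "lists (UNIV :: 'u set) = (\<Union>n\<in>(UNIV :: nat set). ?B n)" by auto
  also have "\<dots> \<lesssim> (UNIV :: 'u set)"
    using card_of_UNION_ordLeq_infinite[OF assms(1), of "UNIV :: nat set" ?B] B
      infinite_iff_card_of_nat[of "UNIV :: 'u set"] assms(1)
    by (simp add: lepoll_iff_ordLeq)
  finally show ?thesis .
qed

text \<open>Together with the bound on the number of formulas this makes \<open>'u\<close> infinite,
  which the cardinal arithmetic for the hull relies on.\<close>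

lemma infinite_wf_fms: "infinite {\<phi>. wf_fm L \<phi>}"
proof
  assume "finite {\<phi>. wf_fm L \<phi>}"
  moreover have "range (\<lambda>n. Eq (Var n) (Var n)) \<subseteq> {\<phi>. wf_fm L \<phi>}" by auto
  ultimately have "finite (range (\<lambda>n. Eq (Var n) (Var n) :: ('a, 'b) fm))"
    by (rule finite_subset[rotated])
  then show False by (auto dest!: finite_imageD simp: inj_on_def)
qed

text \<open>Starting from \<open>A\<close>, each stage adds a chosen witness for every pair of a
  formula and a finite list of earlier elements. A finite list from the union already lies in one
  stage, so its witness appears in the next one.\<close>

lemma skolem_hull:
  fixes M :: "('f, 'r, 'a) struct"
  assumes "is_struct L M" "A \<subseteq> universe M" "finite A"
    and le: "{\<phi>. wf_fm L \<phi>} \<lesssim> (UNIV :: 'u set)"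
  obtains H where "A \<subseteq> H" "H \<subseteq> universe M" "H \<lesssim> (UNIV :: 'u set)"
    "\<And>\<phi> xs. wf_fm L \<phi> \<Longrightarrow> set xs \<subseteq> H \<Longrightarrow> \<exists>a\<in>universe M. holds M (a # xs) \<phi> \<Longrightarrow>
      \<exists>a\<in>H. holds M (a # xs) \<phi>"
proof -
  have inf: "infinite (UNIV :: 'u set)"
    using infinite_wf_fms le by (meson inj_on_finite lepoll_def)
  obtain u where u: "u \<in> universe M"
    using assms(1) by (auto simp: is_struct_def)
  \<comment> \<open>The default \<open>u\<close> keeps the values inside the universe when there is
    no witness, so the stages never leave \<open>M\<close>.\<close>
  define sk where "sk = (\<lambda>(\<phi>, xs). if \<exists>a\<in>universe M. holds M (a # xs) \<phi>
    then SOME a. a \<in> universe M \<and> holds M (a # xs) \<phi> else u)"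
  have sk: "sk (\<phi>, xs) \<in> universe M \<and>
    ((\<exists>a\<in>universe M. holds M (a # xs) \<phi>) \<longrightarrow> holds M (sk (\<phi>, xs) # xs) \<phi>)" for \<phi> xs
  proof (cases "\<exists>a\<in>universe M. holds M (a # xs) \<phi>")
    case True
    then have "\<exists>a. a \<in> universe M \<and> holds M (a # xs) \<phi>" by blast
    from someI_ex[OF this] True show ?thesis by (simp add: sk_def)
  qed (simp add: sk_def u)
  define Hn where "Hn = rec_nat A (\<lambda>_ B. B \<union> sk ` ({\<phi>. wf_fm L \<phi>} \<times> lists B))"
  have Hn0: "Hn 0 = A" by (simp add: Hn_def)
  have HnS: "Hn (Suc n) = Hn n \<union> sk ` ({\<phi>. wf_fm L \<phi>} \<times> lists (Hn n))" for n
    by (simp add: Hn_def)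
  have mono: "Hn n \<subseteq> Hn m" if "n \<le> m" for n m
    using that by (rule lift_Suc_mono_le[rotated]) (simp add: HnS)
  have univ: "Hn n \<subseteq> universe M" for n
  proof (induction n)
    case (Suc n)
    then show ?case using sk by (auto simp: HnS)
  qed (simp add: Hn0 assms)
  have small: "Hn n \<lesssim> (UNIV :: 'u set)" for n
  proof (induction n)
    case 0
    then show ?case using assms(3) inf by (simp add: Hn0 finite_lepoll_infinite)
  next
    case (Suc n)
    have "sk ` ({\<phi>. wf_fm L \<phi>} \<times> lists (Hn n)) \<lesssim> {\<phi>. wf_fm L \<phi>} \<times> lists (Hn n)"
      by (rule image_lepoll)
    also have "\<dots> \<lesssim> (UNIV :: 'u set) \<times> (UNIV :: 'u set)"
      using le lists_lepoll_infinite[OF inf Suc] by (rule times_lepoll_mono)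
    also have "\<dots> \<lesssim> (UNIV :: 'u set)"
      using card_of_Times_same_infinite[OF inf]
      by (simp add: lepoll_iff_ordLeq ordIso_imp_ordLeq)
    finally show ?case
      using card_of_Un_ordLeq_infinite_Field[OF _ _ _ card_of_Card_order, of "UNIV :: 'u set"] Suc inf
      by (simp add: HnS lepoll_iff_ordLeq Field_card_of)
  qed
  show thesis
  proof (rule that[of "\<Union>n. Hn n"])
    show "A \<subseteq> (\<Union>n. Hn n)" using Hn0 by blast
    show "(\<Union>n. Hn n) \<subseteq> universe M" using univ by blast
    show "(\<Union>n. Hn n) \<lesssim> (UNIV :: 'u set)"
      using card_of_UNION_ordLeq_infinite[OF inf, of "UNIV :: nat set" Hn] small
        infinite_iff_card_of_nat[of "UNIV :: 'u set"] inf
      by (simp add: lepoll_iff_ordLeq)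
  next
    fix \<phi> xs assume \<phi>: "wf_fm L \<phi>" and xs: "set xs \<subseteq> (\<Union>n. Hn n)"
      and ex: "\<exists>a\<in>universe M. holds M (a # xs) \<phi>"
    from xs have "\<exists>n. set xs \<subseteq> Hn n"
    proof (induction xs)
      case (Cons x xs)
      then obtain n m where "x \<in> Hn m" "set xs \<subseteq> Hn n" by auto
      with mono[of n "max n m"] mono[of m "max n m"]
      have "set (x # xs) \<subseteq> Hn (max n m)" by auto
      then show ?case ..
    qed simp
    then obtain n where "set xs \<subseteq> Hn n" ..
    then have "xs \<in> lists (Hn n)" by auto
    then have "sk (\<phi>, xs) \<in> Hn (Suc n)"
      using \<phi> by (auto simp: HnS)
    with sk ex show "\<exists>a\<in>(\<Union>n. Hn n). holds M (a # xs) \<phi>" by blast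
  qed
qed

text \<open>This is downward Loewenheim-Skolem with a change of carrier: the hull passes the
  Tarski-Vaught test, and its structure is transported along an injection into
  \<open>'u\<close>.\<close>

lemma small_elementary_copy:
  fixes M :: "('f, 'r, 'a) struct"
  assumes M: "is_struct L M" and A: "A \<subseteq> universe M" "finite A"
    and le: "{\<phi>. wf_fm L \<phi>} \<lesssim> (UNIV :: 'u set)"
  obtains N :: "('f, 'r, 'u) struct" and f where "is_struct L N" "f ` A \<subseteq> universe N"
    "\<And>xs \<phi>. set xs \<subseteq> A \<Longrightarrow> \<phi> \<in> formulas L (length xs) \<Longrightarrow> holds N (map f xs) \<phi> = holds M xs \<phi>"
proof -
  obtain H where H: "A \<subseteq> H" "H \<subseteq> universe M" "H \<lesssim> (UNIV :: 'u set)"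
    and closed: "\<And>\<phi> xs. wf_fm L \<phi> \<Longrightarrow> set xs \<subseteq> H \<Longrightarrow>
      \<exists>a\<in>universe M. holds M (a # xs) \<phi> \<Longrightarrow> \<exists>a\<in>H. holds M (a # xs) \<phi>"
    using skolem_hull[OF M A le] by metis
  obtain f :: "'a \<Rightarrow> 'u" where inj: "inj_on f H"
    using H(3) by (auto simp: lepoll_def)
  define g where "g = inv_into H f"
  have gf: "g (f a) = a" if "a \<in> H" for a
    using that inj by (simp add: g_def)
  define N where "N = \<lparr>universe = f ` H, fnI = (\<lambda>h us. f (fnI M h (map g us))),
    relI = (\<lambda>r us. relI M r (map g us))\<rparr>"
  have fnH: "fnI M h xs \<in> H" if "(h, length xs) \<in> funs L" "set xs \<subseteq> H" for h xs
  proof -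
    \<comment> \<open>The only witness of this formula is the function value itself, so closure
      under witnesses gives closure under functions.\<close>
    let ?\<phi> = "Eq (Var 0) (Fn h (map (\<lambda>i. Var (Suc i)) [0..<length xs]))"
    have hold: "holds M (a # xs) ?\<phi> \<longleftrightarrow> a = fnI M h xs" for a
      by (simp add: holds_def comp_def map_nth)
    have "fnI M h xs \<in> universe M"
      using M that H(2) by (fastforce simp: is_struct_def)
    moreover have "wf_fm L ?\<phi>" using that by (simp add: list_all_iff)
    ultimately have "\<exists>a\<in>H. holds M (a # xs) ?\<phi>"
      using that(2) by (intro closed) (auto simp: hold)
    then show ?thesis by (simp add: hold)
  qed
  have ev: "eval M s t \<in> H \<and> eval N (\<lambda>i. f (s i)) t = f (eval M s t)"
    if "range s \<subseteq> H" "wf_tm L t" for s t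
    using that(2)
  proof (induction t)
    case (Var n)
    then show ?case using that(1) by auto
  next
    case (Fn h ts)
    have IH: "eval M s t \<in> H" "eval N (\<lambda>i. f (s i)) t = f (eval M s t)" if "t \<in> set ts" for t
      using Fn that by (auto simp: list_all_iff)
    have "map g (map (eval N (\<lambda>i. f (s i))) ts) = map (eval M s) ts"
      using IH gf by simp
    moreover have "fnI M h (map (eval M s) ts) \<in> H"
      using Fn.prems IH(1) by (intro fnH) auto
    moreover have "eval N (\<lambda>i. f (s i)) (Fn h ts) =
      f (fnI M h (map g (map (eval N (\<lambda>i. f (s i))) ts)))"
      by (simp add: N_def)
    ultimately show ?case by (simp del: map_map)
  qed
  have sat: "sat N (\<lambda>i. f (s i)) \<phi> = sat M s \<phi>" if "range s \<subseteq> H" "wf_fm L \<phi>" for s \<phi>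
    using that
  proof (induction \<phi> arbitrary: s)
    case (Eq t u)
    then show ?case using ev[of s t] ev[of s u] inj by (auto simp: inj_on_eq_iff)
  next
    case (Rel r ts)
    then have "map g (map (eval N (\<lambda>i. f (s i))) ts) = map (eval M s) ts"
      using ev gf by (simp add: list_all_iff)
    moreover have "sat N (\<lambda>i. f (s i)) (Rel r ts) =
      relI M r (map g (map (eval N (\<lambda>i. f (s i))) ts))"
      by (simp add: N_def)
    ultimately show ?case by (simp del: map_map)
  next
    case (Exi \<phi>)
    have wit: "\<exists>a\<in>H. sat M (case_nat a s) \<phi>" if "a \<in> universe M" "sat M (case_nat a s) \<phi>" for a
    proof -
      \<comment> \<open>The closure property is about finite tuples. Index 0 is the bound variable
        and the free ones are at most \<open>n\<close>, so the first \<open>n\<close> values of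
        \<open>s\<close> are enough.\<close>
      obtain n where "\<forall>i\<in>fv \<phi>. i \<le> n"
        using finite_fv finite_nat_set_iff_bounded_le by metis
      then have \<phi>: "\<phi> \<in> formulas L (Suc n)"
        using Exi.prems by (auto simp: formulas_def)
      define xs where "xs = map s [0..<n]"
      have hold: "sat M (case_nat b s) \<phi> = holds M (b # xs) \<phi>" for b
        using \<phi> by (intro sat_eq_holds) (auto simp: xs_def nth_Cons split: nat.split)
      have "\<exists>a\<in>H. holds M (a # xs) \<phi>"
        using that Exi.prems by (intro closed) (auto simp: hold xs_def)
      then show ?thesis by (simp add: hold)
    qed
    have "sat N (case_nat (f a) (\<lambda>i. f (s i))) \<phi> = sat M (case_nat a s) \<phi>" if "a \<in> H" for a
    proof -
      have "case_nat (f a) (\<lambda>i. f (s i)) = (\<lambda>i. f (case_nat a s i))"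
        by (rule ext) (simp split: nat.split)
      then show ?thesis
        using Exi.IH[of "case_nat a s"] Exi.prems that
        by (auto split: nat.split simp: image_subset_iff)
    qed
    then show ?case using wit H(2) by (auto simp: N_def)
  qed auto
  show thesis
  proof (rule that[of N f])
    obtain u where "u \<in> universe M" using M by (auto simp: is_struct_def)
    then have "\<exists>a\<in>H. holds M [a] (Eq (Var 0) (Var 0))" by (intro closed) auto
    then have ne: "H \<noteq> {}" by auto
    show "is_struct L N"
      unfolding is_struct_def
    proof (intro conjI ballI, safe)
      fix h us assume h: "(h, length us) \<in> funs L" and us: "set us \<subseteq> universe N"
      have "set (map g us) \<subseteq> H"
        using us by (auto simp: N_def gf subset_iff image_iff)
      then show "fnI N h us \<in> universe N"
        using fnH[of h "map g us"] h by (simp add: N_def)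
    qed (use ne in \<open>auto simp: N_def\<close>)
    show "f ` A \<subseteq> universe N" using H(1) by (auto simp: N_def)
    fix xs \<phi> assume xs: "set xs \<subseteq> A" and \<phi>: "\<phi> \<in> formulas L (length xs)"
    obtain a where a: "a \<in> H" using ne by auto
    \<comment> \<open>The transfer was proved for assignments with all values in \<open>H\<close>;
      the list is therefore padded with some element of \<open>H\<close>.\<close>
    define s where "s i = (if i < length xs then xs ! i else a)" for i
    have "range s \<subseteq> H" using xs H(1) a by (auto simp: s_def subset_iff)
    moreover have "wf_fm L \<phi>" using \<phi> by (simp add: formulas_def)
    ultimately have "sat N (\<lambda>i. f (s i)) \<phi> = sat M s \<phi>" by (rule sat)
    moreover have "sat N (\<lambda>i. f (s i)) \<phi> = holds N (map f xs) \<phi>"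
      using \<phi> by (intro sat_eq_holds) (auto simp: s_def)
    moreover have "sat M s \<phi> = holds M xs \<phi>"
      using \<phi> by (intro sat_eq_holds) (auto simp: s_def)
    ultimately show "holds N (map f xs) \<phi> = holds M xs \<phi>" by simp
  qed
qed

section \<open>Realized sequences\<close>

lemma holds_append:
  "\<phi> \<in> formulas L (length xs) \<Longrightarrow> holds M (xs @ ys) \<phi> = holds M xs \<phi>"
  unfolding holds_def[of M "xs @ ys"] by (rule sat_eq_holds) (auto simp: nth_append)

text \<open>\<open>increasing\<close> compares all pairs of entries. Transitivity reduces the new
  comparisons to a single neighbouring one, which is what allows recursion along a sequence.\<close>

lemma increasing_Cons_Cons:
  assumes "transp_on (universe M) (less_in lt M)"
  shows "increasing lt M (a # c # xs) \<longleftrightarrow>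
    a \<in> universe M \<and> less_in lt M a c \<and> increasing lt M (c # xs)"
  using assms by (auto simp: increasing_def dest: transp_onD)

lemma realized_between_Nil:
  "realized_between lt M a b [] \<longleftrightarrow> a \<in> universe M \<and> b \<in> universe M \<and> less_in lt M a b"
  by (auto simp: realized_between_def increasing_def)

lemma realized_between_Cons:
  assumes "transp_on (universe M) (less_in lt M)"
  shows "realized_between lt M a b (\<phi> # \<phi>s) \<longleftrightarrow>
    (\<exists>c. a \<in> universe M \<and> c \<in> universe M \<and> less_in lt M a c \<and> holds M [c] \<phi> \<and>
      realized_between lt M c b \<phi>s)"
proof -
  have "realized_between lt M a b (\<phi> # \<phi>s) \<longleftrightarrow> (\<exists>c cs. increasing lt M (a # c # cs @ [b]) \<and>
      holds M [c] \<phi> \<and> list_all2 (\<lambda>c \<phi>. holds M [c] \<phi>) cs \<phi>s)"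
    unfolding realized_between_def list_all2_Cons2 by (metis append_Cons)
  also have "\<dots> \<longleftrightarrow> (\<exists>c. a \<in> universe M \<and> c \<in> universe M \<and> less_in lt M a c \<and> holds M [c] \<phi> \<and>
      (\<exists>cs. increasing lt M (c # cs @ [b]) \<and> list_all2 (\<lambda>c \<phi>. holds M [c] \<phi>) cs \<phi>s))"
    unfolding increasing_Cons_Cons[OF assms] by (auto simp: increasing_def)
  finally show ?thesis by (simp add: realized_between_def)
qed

text \<open>Index 0 is the left endpoint and index 1 the right one. Under the quantifier the new
  point is 0, the old left endpoint 1 and the right endpoint 2; the renaming makes the new point and
  the right endpoint the ends for the remaining formulas.\<close>

primrec btw :: "'r \<Rightarrow> ('f, 'r) fm list \<Rightarrow> ('f, 'r) fm" where
  "btw lt [] = Rel lt [Var 0, Var 1]"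
| "btw lt (\<phi> # \<phi>s) = Exi (Conj (Rel lt [Var 1, Var 0])
    (Conj \<phi> (rename (case_nat 0 (\<lambda>_. 2)) (btw lt \<phi>s))))"

lemma btw_in_formulas:
  assumes "(lt, 2) \<in> rels L"
  shows "set \<phi>s \<subseteq> formulas L 1 \<Longrightarrow> btw lt \<phi>s \<in> formulas L 2"
proof (induction \<phi>s)
  case Nil
  then show ?case using assms by simp
next
  case (Cons \<phi> \<phi>s)
  have "rename (case_nat 0 (\<lambda>_. 2)) (btw lt \<phi>s) \<in> formulas L (Suc 2)"
    using Cons by (intro rename_in_formulas[of _ _ 2]) (auto split: nat.split)
  moreover have "\<phi> \<in> formulas L (Suc 2)"
    using Cons.prems by (auto intro: formulas_mono[of _ _ 1])
  ultimately show ?case using assms by simp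
qed

lemma holds_btw:
  assumes "transp_on (universe M) (less_in lt M)" "(lt, 2) \<in> rels L"
  shows "set \<phi>s \<subseteq> formulas L 1 \<Longrightarrow> a \<in> universe M \<Longrightarrow> b \<in> universe M \<Longrightarrow>
    holds M [a, b] (btw lt \<phi>s) \<longleftrightarrow> realized_between lt M a b \<phi>s"
proof (induction \<phi>s arbitrary: a)
  case Nil
  then show ?case by (simp add: realized_between_Nil)
next
  case (Cons \<phi> \<phi>s)
  have "holds M [c, a, b] (rename (case_nat 0 (\<lambda>_. 2)) (btw lt \<phi>s)) = holds M [c, b] (btw lt \<phi>s)" for c
    using btw_in_formulas[OF assms(2), of \<phi>s] Cons.prems
    by (intro holds_rename[of _ L]) (auto simp: less_Suc_eq numeral_2_eq_2)
  moreover have "holds M [c, a, b] \<phi> = holds M [c] \<phi>" for c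
    using holds_append[of \<phi> L "[c]" M "[a, b]"] Cons.prems by simp
  ultimately show ?case
    using Cons by (auto simp: realized_between_Cons[OF assms(1)])
qed

text \<open>Collecting the sequences in a set turns the interval condition of \<open>RB\<close> into
  an equation, which also makes sense between two different structures.\<close>

definition rseqs ::
  "('f, 'r) lang \<Rightarrow> 'r \<Rightarrow> ('f, 'r, 'a) struct \<Rightarrow> 'a \<Rightarrow> 'a \<Rightarrow> ('f, 'r) fm list set" where
  "rseqs L lt M a b = {\<phi>s. set \<phi>s \<subseteq> formulas L 1 \<and> realized_between lt M a b \<phi>s}"

lemma rseqs_eq_iff:
  "rseqs L lt M a b = rseqs L lt N c d \<longleftrightarrow> (\<forall>\<phi>s. set \<phi>s \<subseteq> formulas L 1 \<longrightarrow>
    (realized_between lt M a b \<phi>s \<longleftrightarrow> realized_between lt N c d \<phi>s))"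
  by (auto simp: rseqs_def)

lemma rseqs_eq_of_tp_eq:
  assumes "transp_on (universe M) (less_in lt M)" "transp_on (universe N) (less_in lt N)"
    and "(lt, 2) \<in> rels L" "a \<in> universe M" "b \<in> universe M" "c \<in> universe N" "d \<in> universe N"
    and eq: "tp L M [a, b] = tp L N [c, d]"
  shows "rseqs L lt M a b = rseqs L lt N c d"
  unfolding rseqs_eq_iff
proof (intro allI impI)
  fix \<phi>s assume \<phi>s: "set \<phi>s \<subseteq> formulas L 1"
  have "holds M [a, b] (btw lt \<phi>s) = holds N [c, d] (btw lt \<phi>s)"
    using btw_in_formulas[OF assms(3) \<phi>s] by (intro tp_eqD[OF eq]) (auto simp: numeral_2_eq_2)
  then show "realized_between lt M a b \<phi>s = realized_between lt N c d \<phi>s"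
    using assms \<phi>s holds_btw by metis
qed

text \<open>Take the shortest prefix of \<open>t\<close> outside \<open>B\<close>. This isolates the
  single formula at which a sequence ceases to be realizable.\<close>

lemma exists_exit_right:
  assumes "[] \<in> B" "\<And>s a. s @ [a] \<in> A \<Longrightarrow> s \<in> A"
  shows "t \<in> A \<Longrightarrow> t \<notin> B \<Longrightarrow> \<exists>s a. s \<in> B \<and> s @ [a] \<in> A \<and> s @ [a] \<notin> B"
proof (induction t rule: rev_induct)
  case (snoc a t)
  then show ?case using assms(2)[of t a] by blast
qed (use assms in simp)

lemma exists_exit_left:
  assumes "[] \<in> B" "\<And>s a. a # s \<in> A \<Longrightarrow> s \<in> A"
  shows "t \<in> A \<Longrightarrow> t \<notin> B \<Longrightarrow> \<exists>s a. s \<in> B \<and> a # s \<in> A \<and> a # s \<notin> B"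
proof (induction t)
  case (Cons a t)
  then show ?case using assms(2)[of a t] by blast
qed (use assms in simp)

section \<open>Sequences realized between points of one linear order\<close>

locale linear_struct =
  fixes L :: "('f, 'r) lang" and lt :: 'r and M :: "('f, 'r, 'a) struct"
  assumes linear: "linearly_ordered L lt M"
begin

abbreviation U where "U \<equiv> universe M"
abbreviation less (infix "\<sqsubset>" 50) where "x \<sqsubset> y \<equiv> less_in lt M x y"
abbreviation S where "S \<equiv> rseqs L lt M"

lemma transp: "transp_on U (less_in lt M)"
  and lt_in_rels: "(lt, 2) \<in> rels L"
  using linear by (auto simp: linearly_ordered_def)

lemma less_trans: "x \<sqsubset> y \<Longrightarrow> y \<sqsubset> z \<Longrightarrow> x \<in> U \<Longrightarrow> y \<in> U \<Longrightarrow> z \<in> U \<Longrightarrow> x \<sqsubset> z"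
  using transp by (auto dest: transp_onD)

lemma less_irrefl: "x \<in> U \<Longrightarrow> \<not> x \<sqsubset> x"
  using linear by (auto simp: linearly_ordered_def dest: irreflp_onD)

lemma less_linear: "x \<in> U \<Longrightarrow> y \<in> U \<Longrightarrow> x \<sqsubset> y \<or> x = y \<or> y \<sqsubset> x"
  using linear by (auto simp: linearly_ordered_def dest: totalp_onD)

lemma not_less: "x \<in> U \<Longrightarrow> y \<in> U \<Longrightarrow> \<not> x \<sqsubset> y \<longleftrightarrow> x = y \<or> y \<sqsubset> x"
  using less_linear less_trans less_irrefl by blast

lemma Nil_in_S: "[] \<in> S x y \<longleftrightarrow> x \<in> U \<and> y \<in> U \<and> x \<sqsubset> y"
  by (simp add: rseqs_def realized_between_Nil)

lemma Cons_in_S: "\<phi> # s \<in> S x y \<longleftrightarrow> \<phi> \<in> formulas L 1 \<and>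
    (\<exists>c. x \<in> U \<and> c \<in> U \<and> x \<sqsubset> c \<and> holds M [c] \<phi> \<and> s \<in> S c y)"
  by (auto simp: rseqs_def realized_between_Cons[OF transp])

lemma S_imp_less: "s \<in> S x y \<Longrightarrow> x \<in> U \<and> y \<in> U \<and> x \<sqsubset> y"
proof (induction s arbitrary: x)
  case (Cons \<phi> s)
  then obtain c where "x \<in> U" "c \<in> U" "x \<sqsubset> c" "s \<in> S c y" by (auto simp: Cons_in_S)
  then show ?case using Cons.IH less_trans[of x c y] by auto
qed (simp add: Nil_in_S)

lemma S_asym: "x \<sqsubset> y \<Longrightarrow> S y x = {}"
  using S_imp_less less_trans less_irrefl by blast

lemma S_refl: "S x x = {}"
  using S_imp_less less_irrefl by blast

text \<open>The same witnesses serve for the larger interval: by linearity the negated comparison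
  says that \<open>z\<close> equals \<open>y\<close> or lies above it.\<close>

lemma S_mono_right: "s \<in> S x y \<Longrightarrow> \<not> z \<sqsubset> y \<Longrightarrow> z \<in> U \<Longrightarrow> s \<in> S x z"
proof (induction s arbitrary: x)
  case Nil
  then show ?case using less_trans not_less by (metis Nil_in_S)
next
  case (Cons \<phi> s)
  then show ?case by (auto simp: Cons_in_S)
qed

lemma S_mono_left:
  assumes "s \<in> S x y" "\<not> x \<sqsubset> z" "z \<in> U"
  shows "s \<in> S z y"
proof (cases "z = x")
  case False
  have U: "x \<in> U" "y \<in> U" using assms(1) S_imp_less by blast+
  then have zx: "z \<sqsubset> x" using assms False not_less by blast
  show ?thesis
  proof (cases s)
    case Nil
    then show ?thesis using assms U zx less_trans[of z x y] by (auto simp: Nil_in_S)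
  next
    case (Cons \<phi> t)
    then obtain c where "\<phi> \<in> formulas L 1" "c \<in> U" "x \<sqsubset> c" "holds M [c] \<phi>" "t \<in> S c y"
      using assms(1) by (auto simp: Cons_in_S)
    then show ?thesis using Cons assms(3) U zx less_trans[of z x c] by (auto simp: Cons_in_S)
  qed
qed (use assms in simp)

lemma append_Cons_in_S: "s @ \<phi> # t \<in> S x z \<longleftrightarrow>
    \<phi> \<in> formulas L 1 \<and> (\<exists>c. s \<in> S x c \<and> holds M [c] \<phi> \<and> t \<in> S c z)"
proof (induction s arbitrary: x)
  case Nil
  then show ?case using S_imp_less by (auto simp: Cons_in_S Nil_in_S)
next
  case (Cons \<psi> s)
  then show ?case by (auto simp: Cons_in_S)
qed

lemma S_tail:
  assumes "\<phi> # s \<in> S x y"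
  shows "s \<in> S x y"
proof -
  obtain c where c: "x \<in> U" "c \<in> U" "x \<sqsubset> c" "s \<in> S c y"
    using assms by (auto simp: Cons_in_S)
  then have "\<not> c \<sqsubset> x" using less_trans less_irrefl by blast
  then show ?thesis using c S_mono_left by blast
qed

lemma S_butlast:
  assumes "s @ [\<phi>] \<in> S x y"
  shows "s \<in> S x y"
proof -
  obtain c where c: "s \<in> S x c" "y \<in> U" "c \<in> U" "c \<sqsubset> y"
    using assms by (auto simp: append_Cons_in_S Nil_in_S)
  then have "\<not> y \<sqsubset> c" using less_trans less_irrefl by blast
  then show ?thesis using c S_mono_right by blast
qed

lemma append_in_S: "s \<in> S x y \<Longrightarrow> t \<in> S y z \<Longrightarrow> s @ t \<in> S x z"
proof (induction s arbitrary: x)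
  case Nil
  then show ?case
    using S_mono_left[of t y z x] less_trans less_irrefl by (auto simp: Nil_in_S)
next
  case (Cons \<phi> s)
  then show ?case by (auto simp: Cons_in_S)
qed

text \<open>A strictly increasing chain of witnesses either jumps over \<open>c\<close> or passes
  through it exactly once, and in the latter case the formula met there belongs to the type of
  \<open>c\<close>.\<close>

lemma S_split_iff:
  assumes "x \<in> U" "c \<in> U" "y \<in> U" "x \<sqsubset> c" "c \<sqsubset> y"
  shows "s \<in> S x y \<longleftrightarrow> (\<exists>s1 s2. s = s1 @ s2 \<and> s1 \<in> S x c \<and> s2 \<in> S c y) \<or>
    (\<exists>s1 \<phi> s2. s = s1 @ \<phi> # s2 \<and> s1 \<in> S x c \<and> \<phi> \<in> tp L M [c] \<and> s2 \<in> S c y)"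
proof
  assume "s \<in> S x y"
  then show "(\<exists>s1 s2. s = s1 @ s2 \<and> s1 \<in> S x c \<and> s2 \<in> S c y) \<or>
    (\<exists>s1 \<phi> s2. s = s1 @ \<phi> # s2 \<and> s1 \<in> S x c \<and> \<phi> \<in> tp L M [c] \<and> s2 \<in> S c y)"
    using assms(1,4)
  proof (induction s arbitrary: x)
    case Nil
    then show ?case using assms by (auto simp: Nil_in_S)
  next
    case (Cons \<phi> s)
    then obtain d where \<phi>: "\<phi> \<in> formulas L 1"
      and d: "d \<in> U" "x \<sqsubset> d" "holds M [d] \<phi>" "s \<in> S d y"
      by (auto simp: Cons_in_S)
    consider "d \<sqsubset> c" | "d = c" | "c \<sqsubset> d"
      using less_linear d assms by blast
    then show ?case
    proof cases
      case 1
      have step: "\<phi> # t \<in> S x c" if "t \<in> S d c" for t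
        using that \<phi> d Cons.prems by (auto simp: Cons_in_S)
      from Cons.IH[OF d(4,1) 1] show ?thesis
      proof (elim disjE exE conjE)
        fix s1 s2 assume "s = s1 @ s2" "s1 \<in> S d c" "s2 \<in> S c y"
        then have "\<phi> # s = (\<phi> # s1) @ s2 \<and> \<phi> # s1 \<in> S x c \<and> s2 \<in> S c y"
          using step by simp
        then show ?thesis by blast
      next
        fix s1 \<psi> s2 assume "s = s1 @ \<psi> # s2" "s1 \<in> S d c" "\<psi> \<in> tp L M [c]" "s2 \<in> S c y"
        then have "\<phi> # s = (\<phi> # s1) @ \<psi> # s2 \<and> \<phi> # s1 \<in> S x c \<and> \<psi> \<in> tp L M [c] \<and> s2 \<in> S c y"
          using step by simp
        then show ?thesis by blast
      qed
    next
      case 2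
      then have "\<phi> # s = [] @ \<phi> # s \<and> [] \<in> S x c \<and> \<phi> \<in> tp L M [c] \<and> s \<in> S c y"
        using d \<phi> Cons.prems by (auto simp: Nil_in_S tp_def)
      then show ?thesis by blast
    next
      case 3
      then have "\<phi> # s = [] @ \<phi> # s \<and> [] \<in> S x c \<and> \<phi> # s \<in> S c y"
        using d \<phi> Cons.prems assms by (auto simp: Nil_in_S Cons_in_S)
      then show ?thesis by blast
    qed
  qed
qed (auto simp: append_Cons_in_S tp_def intro: append_in_S)

text \<open>The right-hand side of \<open>S_split_iff\<close> mentions the middle point only through
  its type and the two sets. That the primed points are ordered in the same way follows from
  membership of the empty sequence.\<close>

lemma S_compose:
  assumes "x \<sqsubset> c" "c \<sqsubset> y" "x \<in> U" "c \<in> U" "y \<in> U"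
    and "S x' c' = S x c" "S c' y' = S c y" "tp L M [c'] = tp L M [c]"
  shows "S x' y' = S x y"
proof -
  have "[] \<in> S x' c'" "[] \<in> S c' y'" using assms by (auto simp: Nil_in_S)
  then have "x' \<in> U" "c' \<in> U" "y' \<in> U" "x' \<sqsubset> c'" "c' \<sqsubset> y'" by (auto simp: Nil_in_S)
  with assms show ?thesis
    by (intro set_eqI) (simp only: S_split_iff)
qed

text \<open>For fixed \<open>x'\<close> the sets \<open>{w. s \<in> S x' w}\<close> are upward closed, hence linearly ordered by
  inclusion, so finitely many sequences can be replaced by a single one.\<close>

lemma finite_S_right:
  assumes that: "x \<in> U" "c \<in> U" "x \<sqsubset> c" and F: "finite F" "F \<subseteq> S x c"
  shows "\<exists>s\<in>S x c. \<forall>w. s \<in> S x' w \<longrightarrow> F \<subseteq> S x' w"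
  using F
proof (induction F)
  case empty
  have "[] \<in> S x c" using that by (simp add: Nil_in_S)
  then show ?case by blast
next
  case (insert t F)
  then obtain s where s: "s \<in> S x c" "\<forall>w. s \<in> S x' w \<longrightarrow> F \<subseteq> S x' w" by auto
  show ?case
  proof (cases "\<forall>w. s \<in> S x' w \<longrightarrow> t \<in> S x' w")
    case True
    then show ?thesis using s by blast
  next
    case False
    then obtain w where w: "s \<in> S x' w" "t \<notin> S x' w" by blast
    have "s \<in> S x' w2" if t: "t \<in> S x' w2" for w2
    proof -
      have wU: "w \<in> U" "w2 \<in> U" using w t S_imp_less by blast+
      then have "w \<sqsubset> w2" using t w(2) S_mono_right by blast
      then have "\<not> w2 \<sqsubset> w" using wU less_trans less_irrefl by blast
      then show ?thesis using w(1) wU S_mono_right by blast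
    qed
    then show ?thesis using s insert.prems by blast
  qed
qed

text \<open>Here the right endpoint is fixed and the sets of admissible left endpoints are downward
  closed, so they again form a chain under inclusion.\<close>

lemma finite_S_left:
  assumes that: "c \<in> U" "y \<in> U" "c \<sqsubset> y" and F: "finite F" "F \<subseteq> S c y"
  shows "\<exists>s\<in>S c y. \<forall>w. s \<in> S w y' \<longrightarrow> F \<subseteq> S w y'"
  using F
proof (induction F)
  case empty
  have "[] \<in> S c y" using that by (simp add: Nil_in_S)
  then show ?case by blast
next
  case (insert t F)
  then obtain s where s: "s \<in> S c y" "\<forall>w. s \<in> S w y' \<longrightarrow> F \<subseteq> S w y'" by auto
  show ?case
  proof (cases "\<forall>w. s \<in> S w y' \<longrightarrow> t \<in> S w y'")
    case True
    then show ?thesis using s by blast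
  next
    case False
    then obtain w where w: "s \<in> S w y'" "t \<notin> S w y'" by blast
    have "s \<in> S w2 y'" if t: "t \<in> S w2 y'" for w2
    proof -
      have wU: "w \<in> U" "w2 \<in> U" using w t S_imp_less by blast+
      then have "w2 \<sqsubset> w" using t w(2) S_mono_left by blast
      then have "\<not> w \<sqsubset> w2" using wU less_trans less_irrefl by blast
      then show ?thesis using w(1) wU S_mono_left by blast
    qed
    then show ?thesis using s insert.prems by blast
  qed
qed

lemma rseqs_eq_of_tp_eq':
  assumes "tp L M [a, b] = tp L M [c, d]" "a \<in> U" "b \<in> U" "c \<in> U" "d \<in> U"
  shows "S a b = S c d"
  using assms rseqs_eq_of_tp_eq transp lt_in_rels by metis

end

section \<open>Copying a point relative to one or two endpoints\<close>

locale saturated_linear_struct = linear_struct L lt M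
  for L :: "('f, 'r) lang" and lt :: 'r and M :: "('f, 'r, 'a) struct" +
  assumes saturated: "omega_saturated L M"
begin

lemma realize:
  assumes "set as \<subseteq> U" "\<Phi> \<subseteq> formulas L (Suc (length as))"
    and "\<And>\<Psi>. \<Psi> \<subseteq> \<Phi> \<Longrightarrow> finite \<Psi> \<Longrightarrow> \<exists>c\<in>U. \<forall>\<phi>\<in>\<Psi>. holds M (c # as) \<phi>"
  shows "\<exists>c\<in>U. \<forall>\<phi>\<in>\<Phi>. holds M (c # as) \<phi>"
  using saturated assms by (simp add: omega_saturated_def)

text \<open>Finitely many formulas true of \<open>c # xs\<close> are witnessed over
  \<open>xs'\<close>, because the existential closure of their conjunction belongs to the common
  type; saturation then realizes them all. Since the type contains negations, the realization has
  exactly this type. The structure \<open>N\<close> may differ from \<open>M\<close>, which later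
  brings tuples of other models into \<open>M\<close>.\<close>

lemma extend_tp:
  fixes N :: "('f, 'r, 'b) struct"
  assumes eq: "tp L M xs' = tp L N xs" and len: "length xs' = length xs"
    and xs': "set xs' \<subseteq> U" and c: "c \<in> universe N"
  shows "\<exists>c'\<in>U. tp L M (c' # xs') = tp L N (c # xs)"
proof -
  let ?\<Phi> = "tp L N (c # xs)"
  have \<Phi>: "?\<Phi> \<subseteq> formulas L (Suc (length xs'))"
    by (auto simp: tp_def len)
  have fin: "\<exists>c'\<in>U. \<forall>\<psi>\<in>\<Psi>. holds M (c' # xs') \<psi>" if \<Psi>: "\<Psi> \<subseteq> ?\<Phi>" "finite \<Psi>" for \<Psi>
  proof -
    obtain \<psi>s where \<psi>s: "set \<psi>s = \<Psi>" using \<Psi>(2) finite_list by blast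
    have "holds N xs (Exi (conjs \<psi>s))"
      using \<Psi>(1) c by (auto simp: \<psi>s tp_def)
    moreover have "Exi (conjs \<psi>s) \<in> formulas L (length xs')"
      using \<Psi>(1) \<Phi> by (auto simp: \<psi>s)
    ultimately have "holds M xs' (Exi (conjs \<psi>s))"
      using tp_eqD[OF eq len] by blast
    then show ?thesis by (auto simp: \<psi>s)
  qed
  obtain c' where c': "c' \<in> U" "\<forall>\<phi>\<in>?\<Phi>. holds M (c' # xs') \<phi>"
    using realize[OF xs' \<Phi> fin] by blast
  have "holds M (c' # xs') \<phi> = holds N (c # xs) \<phi>"
    if \<phi>: "\<phi> \<in> formulas L (length (c' # xs'))" for \<phi>
  proof (cases "holds N (c # xs) \<phi>")
    case True
    then have "\<phi> \<in> ?\<Phi>" using \<phi> by (simp add: tp_def len)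
    then show ?thesis using c'(2) True by blast
  next
    case False
    then have "Neg \<phi> \<in> ?\<Phi>" using \<phi> by (simp add: tp_def len)
    then show ?thesis using c'(2) False by auto
  qed
  then have "tp L M (c' # xs') = tp L N (c # xs)"
    by (intro tp_eqI) (auto simp: len)
  then show ?thesis using c'(1) by blast
qed

text \<open>The type of the pair fixes the realized sequences in both directions, so this serves for
  new points on either side of \<open>x\<close>.\<close>

lemma exists_right:
  assumes "tp L M [x'] = tp L M [x]" "x \<in> U" "x' \<in> U" "c \<in> U"
  obtains c' where "c' \<in> U" "tp L M [c'] = tp L M [c]" "S x' c' = S x c" "S c' x' = S c x"
proof -
  obtain c' where c': "c' \<in> U" "tp L M [c', x'] = tp L M [c, x]"
    using extend_tp[OF assms(1), of c] assms by auto
  have "tp L M [x', c'] = tp L M [x, c]" "tp L M [c'] = tp L M [c]"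
    using tp_eq_sub[OF c'(2), of "[1, 0]"] tp_eq_sub[OF c'(2), of "[0]"] by auto
  then show thesis
    using that c' assms rseqs_eq_of_tp_eq' by metis
qed

text \<open>Finitely many requirements on \<open>w\<close> collapse to one sequence \<open>s\<close>
  on the left, one formula from the type of \<open>c\<close>, and one sequence \<open>t\<close> on
  the right. Their concatenation is realized between \<open>x\<close> and \<open>y\<close> through
  \<open>c\<close>, hence also between \<open>x'\<close> and \<open>y'\<close>. That a sequence is
  not realized cannot be transferred in this way, so only inclusions result.\<close>

lemma exists_approx_between:
  assumes S: "S x' y' = S x y" and xy: "x \<in> U" "y \<in> U" "c \<in> U" "x \<sqsubset> c" "c \<sqsubset> y"
  obtains w where "w \<in> U" "tp L M [w] = tp L M [c]" "S x c \<subseteq> S x' w" "S c y \<subseteq> S w y'"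
proof -
  have "[] \<in> S x' y'" using xy less_trans by (auto simp: S Nil_in_S)
  then have xy': "x' \<in> U" "y' \<in> U" by (auto simp: Nil_in_S)
  \<comment> \<open>In the tuple \<open>[w, x', y']\<close> the formula \<open>?f s\<close> uses
    \<open>x'\<close> and \<open>w\<close> as left and right endpoints, while \<open>?g s\<close>
    uses \<open>w\<close> and \<open>y'\<close>.\<close>
  let ?f = "\<lambda>s. rename (case_nat 1 (\<lambda>_. 0)) (btw lt s)"
  let ?g = "\<lambda>s. rename (case_nat 0 (\<lambda>_. 2)) (btw lt s)"
  have fm: "btw lt s \<in> formulas L 2" if "s \<in> S a b" for s a b
    using that btw_in_formulas[OF lt_in_rels] unfolding rseqs_def by blast
  have f: "?f s \<in> formulas L 3" "?g s \<in> formulas L 3" if "s \<in> S a b" for s a b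
    using fm[OF that] by (auto intro!: rename_in_formulas[of _ _ 2] split: nat.split)
  have hold: "holds M [w, x', y'] (?f s) \<longleftrightarrow> s \<in> S x' w"
    "holds M [w, x', y'] (?g s) \<longleftrightarrow> s \<in> S w y'" if "s \<in> S a b" "w \<in> U" for s a b w
  proof -
    have s: "set s \<subseteq> formulas L 1" using that by (simp add: rseqs_def)
    have "holds M [w, x', y'] (?f s) = holds M [x', w] (btw lt s)"
      "holds M [w, x', y'] (?g s) = holds M [w, y'] (btw lt s)"
      using fm[OF that(1)]
      by (auto intro!: holds_rename[of _ L] simp: less_Suc_eq numeral_2_eq_2)
    then show "holds M [w, x', y'] (?f s) \<longleftrightarrow> s \<in> S x' w"
      "holds M [w, x', y'] (?g s) \<longleftrightarrow> s \<in> S w y'"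
      using holds_btw[OF transp lt_in_rels s] s that xy' by (auto simp: rseqs_def)
  qed
  have hold1: "holds M [w, x', y'] \<phi> = holds M [w] \<phi>" if "\<phi> \<in> formulas L 1" for \<phi> w
    using holds_append[of \<phi> L "[w]" M "[x', y']"] that by simp
  let ?\<Phi> = "tp L M [c] \<union> ?f ` S x c \<union> ?g ` S c y"
  have \<Phi>: "?\<Phi> \<subseteq> formulas L (Suc (length [x', y']))"
    using f by (auto simp: tp_def numeral_3_eq_3 intro: formulas_mono)
  have fin: "\<exists>w\<in>U. \<forall>\<psi>\<in>\<Psi>. holds M (w # [x', y']) \<psi>" if \<Psi>: "\<Psi> \<subseteq> ?\<Phi>" "finite \<Psi>" for \<Psi>
  proof -
    obtain \<psi>s where \<psi>s: "set \<psi>s = \<Psi> \<inter> tp L M [c]"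
      using \<Psi>(2) finite_list by (metis finite_Int)
    obtain F where F: "F \<subseteq> S x c" "finite F" "\<Psi> \<inter> ?f ` S x c = ?f ` F"
      using finite_subset_image[of "\<Psi> \<inter> ?f ` S x c" ?f "S x c"] \<Psi>(2) by auto
    obtain G where G: "G \<subseteq> S c y" "finite G" "\<Psi> \<inter> ?g ` S c y = ?g ` G"
      using finite_subset_image[of "\<Psi> \<inter> ?g ` S c y" ?g "S c y"] \<Psi>(2) by auto
    obtain s where s: "s \<in> S x c" "\<forall>w. s \<in> S x' w \<longrightarrow> F \<subseteq> S x' w"
      using finite_S_right[OF xy(1,3,4) F(2,1)] by blast
    obtain t where t: "t \<in> S c y" "\<forall>w. t \<in> S w y' \<longrightarrow> G \<subseteq> S w y'"
      using finite_S_left[OF xy(3,2,5) G(2,1)] by blast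
    have \<psi>: "conjs \<psi>s \<in> formulas L 1" "holds M [c] (conjs \<psi>s)"
      using \<psi>s by (auto simp: tp_def)
    then have "s @ conjs \<psi>s # t \<in> S x y"
      using s t by (auto simp: append_Cons_in_S)
    then obtain w where w: "s \<in> S x' w" "holds M [w] (conjs \<psi>s)" "t \<in> S w y'"
      by (auto simp: append_Cons_in_S simp flip: S)
    then have wU: "w \<in> U" using S_imp_less by blast
    have "holds M [w, x', y'] \<psi>" if "\<psi> \<in> \<Psi>" for \<psi>
    proof -
      have "\<psi> \<in> set \<psi>s \<or> \<psi> \<in> ?f ` F \<or> \<psi> \<in> ?g ` G"
      proof -
        have "\<psi> \<in> tp L M [c] \<or> \<psi> \<in> ?f ` S x c \<or> \<psi> \<in> ?g ` S c y"
          using that \<Psi>(1) by blast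
        then show "\<psi> \<in> set \<psi>s \<or> \<psi> \<in> ?f ` F \<or> \<psi> \<in> ?g ` G"
          using that unfolding F(3)[symmetric] G(3)[symmetric] \<psi>s by simp
      qed
      then show ?thesis
      proof (elim disjE imageE)
        assume "\<psi> \<in> set \<psi>s"
        then show ?thesis using w(2) \<psi>s by (auto simp: tp_def hold1)
      next
        fix u assume "\<psi> = ?f u" "u \<in> F"
        then show ?thesis using F(1) s w(1) hold(1)[of u x c w] wU by auto
      next
        fix u assume "\<psi> = ?g u" "u \<in> G"
        then show ?thesis using G(1) t w(3) hold(2)[of u c y w] wU by auto
      qed
    qed
    then show ?thesis using wU by auto
  qed
  obtain w where w: "w \<in> U" "\<forall>\<phi>\<in>?\<Phi>. holds M (w # [x', y']) \<phi>"
    using realize[OF _ \<Phi> fin] xy' by auto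
  have "holds M [w] \<phi> = holds M [c] \<phi>" if \<phi>: "\<phi> \<in> formulas L (length [w])" for \<phi>
  proof (cases "holds M [c] \<phi>")
    case True
    then have "\<phi> \<in> ?\<Phi>" using \<phi> by (simp add: tp_def)
    then have "holds M [w, x', y'] \<phi>" using w(2) by blast
    then show ?thesis using True \<phi> by (auto simp: hold1)
  next
    case False
    then have "Neg \<phi> \<in> ?\<Phi>" using \<phi> by (simp add: tp_def)
    then have "holds M [w, x', y'] (Neg \<phi>)" using w(2) by blast
    then show ?thesis using False \<phi> by (auto simp: hold1)
  qed
  then have "tp L M [w] = tp L M [c]" by (intro tp_eqI) auto
  moreover have "S x c \<subseteq> S x' w"
  proof
    fix s assume s: "s \<in> S x c"
    then have "holds M [w, x', y'] (?f s)" using w(2) by blast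
    then show "s \<in> S x' w" using hold(1)[OF s w(1)] by blast
  qed
  moreover have "S c y \<subseteq> S w y'"
  proof
    fix s assume s: "s \<in> S c y"
    then have "holds M [w, x', y'] (?g s)" using w(2) by blast
    then show "s \<in> S w y'" using hold(2)[OF s w(1)] by blast
  qed
  ultimately show thesis using that w(1) by blast
qed

text \<open>The candidate \<open>c1\<close> is correct on the left and \<open>c2\<close> on the right. If both fail, a sequence
  ending in \<open>\<tau>\<close> becomes realized too early to the left of \<open>c2\<close> and a sequence starting with \<open>\<nu>\<close> too
  late to the right of \<open>c1\<close>. But "the first \<open>\<tau>\<close> after \<open>c\<close> comes before the next \<open>\<nu>\<close>" is expressed by a
  formula in \<open>c\<close> alone, so \<open>c1\<close> inherits it, and the two sequences can be concatenated.\<close>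

lemma back_and_forth_between:
  assumes S: "S x' y' = S x y" and xy: "x \<in> U" "y \<in> U" "c \<in> U" "x \<sqsubset> c" "c \<sqsubset> y"
    and tpx: "tp L M [x'] = tp L M [x]" and tpy: "tp L M [y'] = tp L M [y]"
  obtains c' where "c' \<in> U" "tp L M [c'] = tp L M [c]" "S x' c' = S x c" "S c' y' = S c y"
proof -
  have "[] \<in> S x' y'" using xy less_trans by (auto simp: S Nil_in_S)
  then have xy': "x' \<in> U" "y' \<in> U" by (auto simp: Nil_in_S)
  obtain w where w: "w \<in> U" "tp L M [w] = tp L M [c]" "S x c \<subseteq> S x' w" "S c y \<subseteq> S w y'"
    using exists_approx_between[OF S xy] .
  \<comment> \<open>If \<open>w\<close> realizes too much on the left, the exact copy of
    \<open>c\<close> over \<open>x'\<close> must lie below \<open>w\<close>; moving down to it only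
    enlarges the set on the right, so that inclusion survives.\<close>
  obtain c1 where c1: "c1 \<in> U" "tp L M [c1] = tp L M [c]" "S x' c1 = S x c" "S c y \<subseteq> S c1 y'"
  proof (cases "S x' w = S x c")
    case True
    then show thesis using that w by blast
  next
    case False
    then obtain t where t: "t \<in> S x' w" "t \<notin> S x c" using w(3) by blast
    obtain c1 where c1: "c1 \<in> U" "tp L M [c1] = tp L M [c]" "S x' c1 = S x c"
      using exists_right[OF tpx] xy xy' by metis
    have "c1 \<sqsubset> w" using t c1 S_mono_right by blast
    then have "\<not> w \<sqsubset> c1" using c1 w less_trans less_irrefl by blast
    then have "S w y' \<subseteq> S c1 y'" using c1 S_mono_left by blast
    then show thesis using that c1 w(4) by blast
  qed
  obtain c2 where c2: "c2 \<in> U" "tp L M [c2] = tp L M [c]" "S c2 y' = S c y" "S x c \<subseteq> S x' c2"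
  proof (cases "S w y' = S c y")
    case True
    then show thesis using that w by blast
  next
    case False
    then obtain t where t: "t \<in> S w y'" "t \<notin> S c y" using w(4) by blast
    obtain c2 where c2: "c2 \<in> U" "tp L M [c2] = tp L M [c]" "S c2 y' = S c y"
      using exists_right[OF tpy] xy xy' by metis
    have "w \<sqsubset> c2" using t c2 S_mono_left by blast
    then have "\<not> c2 \<sqsubset> w" using c2 w less_trans less_irrefl by blast
    then have "S x' w \<subseteq> S x' c2" using c2 S_mono_right by blast
    then show thesis using that c2 w(3) by blast
  qed
  have "S c1 y' = S c y \<or> S x' c2 = S x c"
  proof (rule ccontr)
    assume *: "\<not> ?thesis"
    \<comment> \<open>Passing to a shortest bad prefix, and below to a shortest bad suffix, makes
      \<open>t1\<close> and \<open>v1\<close> themselves harmless: the failures are due to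
      \<open>\<tau>\<close> and \<open>\<nu>\<close> alone.\<close>
    obtain t where "t \<in> S x' c2" "t \<notin> S x c" using * c2(4) by blast
    then obtain t1 \<tau> where t1: "t1 \<in> S x c"
      and \<tau>: "t1 @ [\<tau>] \<in> S x' c2" "t1 @ [\<tau>] \<notin> S x c"
      using exists_exit_right[of "S x c" "S x' c2" t] S_butlast xy by (auto simp: Nil_in_S)
    obtain v where "v \<in> S c1 y'" "v \<notin> S c y" using * c1(4) by blast
    then obtain v1 \<nu> where v1: "v1 \<in> S c y"
      and \<nu>: "\<nu> # v1 \<in> S c1 y'" "\<nu> # v1 \<notin> S c y"
      using exists_exit_left[of "S c y" "S c1 y'" v] S_tail xy by (auto simp: Nil_in_S)
    have fm: "\<tau> \<in> formulas L 1" "\<nu> \<in> formulas L 1"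
      using \<tau>(1) \<nu>(1) by (auto simp: Cons_in_S append_Cons_in_S)
    have late: "\<not> q \<sqsubset> c" if "t1 \<in> S x q" "holds M [q] \<tau>" "q \<in> U" for q
      using that \<tau>(2) fm xy by (auto simp: append_Cons_in_S Nil_in_S)
    \<comment> \<open>The point \<open>c2\<close> is the joint: \<open>t1\<close> and
      \<open>\<tau>\<close> are realized below it and \<open>v1\<close> above it.\<close>
    have "(t1 @ [\<tau>]) @ v1 \<in> S x y"
      unfolding S[symmetric] using \<tau>(1) v1 c2(3) append_in_S by blast
    then obtain q where q: "t1 \<in> S x q" "holds M [q] \<tau>" "v1 \<in> S q y"
      by (auto simp: append_Cons_in_S)
    have qU: "q \<in> U" using q(1) S_imp_less by blast
    have no\<nu>: "q \<sqsubset> z" if "z \<in> U" "c \<sqsubset> z" "holds M [z] \<nu>" for z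
    proof (rule ccontr)
      assume "\<not> q \<sqsubset> z"
      then have "v1 \<in> S z y" using q(3) that S_mono_left by blast
      then show False using \<nu>(2) that fm xy by (auto simp: Cons_in_S)
    qed
    \<comment> \<open>In the innermost scope 0 is the \<open>\<nu>\<close>-point, 1 the
      \<open>\<tau>\<close>-point and 2 the given element. The first comparison is negated so that
      the \<open>\<tau>\<close>-point may coincide with the given element.\<close>
    let ?\<theta> = "Exi (Conj (Neg (Rel lt [Var 0, Var 1])) (Conj \<tau>
      (Neg (Exi (Conj (Rel lt [Var 2, Var 0]) (Conj (Neg (Rel lt [Var 1, Var 0])) \<nu>))))))"
    have \<theta>: "holds M [e] ?\<theta> \<longleftrightarrow> (\<exists>q\<in>U. \<not> q \<sqsubset> e \<and> holds M [q] \<tau> \<and>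
        (\<forall>z\<in>U. e \<sqsubset> z \<longrightarrow> holds M [z] \<nu> \<longrightarrow> q \<sqsubset> z))" for e
      using holds_append[of \<tau> L "[q]" M "[e]" for q] holds_append[of \<nu> L "[z]" M "[q, e]" for z q] fm
      by auto
    have "?\<theta> \<in> formulas L (length [c1])"
      using fm lt_in_rels by (auto intro: formulas_mono)
    moreover have "holds M [c] ?\<theta>"
      unfolding \<theta> using q qU late no\<nu> by blast
    ultimately have "holds M [c1] ?\<theta>"
      using tp_eqD[OF c1(2)] by (metis length_Cons)
    then obtain q' where q': "q' \<in> U" "\<not> q' \<sqsubset> c1" "holds M [q'] \<tau>"
      and q'\<nu>: "\<And>z. z \<in> U \<Longrightarrow> c1 \<sqsubset> z \<Longrightarrow> holds M [z] \<nu> \<Longrightarrow> q' \<sqsubset> z"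
      unfolding \<theta> by blast
    obtain z where z: "z \<in> U" "c1 \<sqsubset> z" "holds M [z] \<nu>" "v1 \<in> S z y'"
      using \<nu>(1) by (auto simp: Cons_in_S)
    have "\<nu> # v1 \<in> S q' y'"
      using z q' q'\<nu> fm by (auto simp: Cons_in_S)
    moreover have "t1 \<in> S x' q'"
      using t1 q' S_mono_right unfolding c1(3)[symmetric] by blast
    \<comment> \<open>Brought back between \<open>x\<close> and \<open>y\<close>, the
      \<open>\<tau>\<close>-point \<open>r\<close> cannot precede \<open>c\<close> by
      \<open>late\<close>, so \<open>\<nu> # v1\<close> would be realized between \<open>c\<close>
      and \<open>y\<close> after all.\<close>
    ultimately have "t1 @ \<tau> # \<nu> # v1 \<in> S x y"
      unfolding S[symmetric] using q' fm by (auto simp: append_Cons_in_S)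
    then obtain r where r: "t1 \<in> S x r" "holds M [r] \<tau>" "\<nu> # v1 \<in> S r y"
      by (subst (asm) append_Cons_in_S) blast
    have "r \<in> U" using r(1) S_imp_less by blast
    then have "\<nu> # v1 \<in> S c y" using late r xy S_mono_left by blast
    then show False using \<nu>(2) by simp
  qed
  then show thesis
  proof
    assume "S c1 y' = S c y"
    then show thesis using that c1 by blast
  next
    assume "S x' c2 = S x c"
    then show thesis using that c2 by blast
  qed
qed

end

section \<open>Matching tuples and their extension by one point\<close>

context linear_struct
begin

text \<open>The tuples may be unsorted and contain repetitions. Ranging over all ordered pairs, the
  equality of sets forces equal order and equal coincidences of entries through the empty
  sequence.\<close>

definition match :: "'a list \<Rightarrow> 'a list \<Rightarrow> bool" where
  "match as bs \<longleftrightarrow> length as = length bs \<and> set as \<subseteq> U \<and> set bs \<subseteq> U \<and>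
    (\<forall>i<length as. tp L M [as ! i] = tp L M [bs ! i]) \<and>
    (\<forall>i<length as. \<forall>j<length as. S (as ! i) (as ! j) = S (bs ! i) (bs ! j))"

lemma match_less:
  assumes "match as bs" "i < length as" "j < length as"
  shows "as ! i \<sqsubset> as ! j \<longleftrightarrow> bs ! i \<sqsubset> bs ! j"
proof -
  have "as ! i \<in> U" "as ! j \<in> U" "bs ! i \<in> U" "bs ! j \<in> U"
    using assms by (auto simp: match_def)
  moreover have "[] \<in> S (as ! i) (as ! j) \<longleftrightarrow> [] \<in> S (bs ! i) (bs ! j)"
    using assms by (simp add: match_def)
  ultimately show ?thesis by (simp add: Nil_in_S)
qed

lemma match_eq:
  assumes "match as bs" "i < length as" "j < length as"
  shows "as ! i = as ! j \<longleftrightarrow> bs ! i = bs ! j"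
proof -
  have "as ! i \<in> U" "as ! j \<in> U" "bs ! i \<in> U" "bs ! j \<in> U"
    using assms by (auto simp: match_def)
  then show ?thesis
    using match_less[OF assms] match_less[OF assms(1,3,2)] less_linear less_irrefl by metis
qed

lemma match_ConsI:
  assumes "match as bs" "c \<in> U" "d \<in> U" "tp L M [d] = tp L M [c]"
    and "\<And>i. i < length as \<Longrightarrow> S (bs ! i) d = S (as ! i) c"
    and "\<And>i. i < length as \<Longrightarrow> S d (bs ! i) = S c (as ! i)"
  shows "match (c # as) (d # bs)"
  using assms by (auto simp: match_def S_refl less_Suc_eq_0_disj)

text \<open>Working with indices tolerates repeated entries; together with the minimal version it
  supplies the nearest entries on the two sides of a new point.\<close>

lemma exists_maximal:
  assumes "finite I" "I \<noteq> {}" "f ` I \<subseteq> U"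
  shows "\<exists>i\<in>I. \<forall>j\<in>I. \<not> f i \<sqsubset> f j"
  using assms
proof (induction I rule: finite_ne_induct)
  case (singleton x)
  then show ?case using less_irrefl by auto
next
  case (insert x F)
  then obtain i where i: "i \<in> F" "\<forall>j\<in>F. \<not> f i \<sqsubset> f j" by auto
  have U: "f ` insert x F \<subseteq> U" using insert.prems .
  show ?case
  proof (cases "f i \<sqsubset> f x")
    case True
    have "\<not> f x \<sqsubset> f j" if j: "j \<in> insert x F" for j
    proof
      assume "f x \<sqsubset> f j"
      then have "j \<noteq> x" "f i \<sqsubset> f j"
        using True j i(1) U less_irrefl less_trans[of "f i" "f x" "f j"] by auto
      then show False using i j by auto
    qed
    then show ?thesis by blast
  qed (use i in auto)
qed

lemma exists_minimal:
  assumes "finite I" "I \<noteq> {}" "f ` I \<subseteq> U"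
  shows "\<exists>i\<in>I. \<forall>j\<in>I. \<not> f j \<sqsubset> f i"
  using assms
proof (induction I rule: finite_ne_induct)
  case (singleton x)
  then show ?case using less_irrefl by auto
next
  case (insert x F)
  then obtain i where i: "i \<in> F" "\<forall>j\<in>F. \<not> f j \<sqsubset> f i" by auto
  have U: "f ` insert x F \<subseteq> U" using insert.prems .
  show ?case
  proof (cases "f x \<sqsubset> f i")
    case True
    have "\<not> f j \<sqsubset> f x" if j: "j \<in> insert x F" for j
    proof
      assume "f j \<sqsubset> f x"
      then have "j \<noteq> x" "f j \<sqsubset> f i"
        using True j i(1) U less_irrefl less_trans[of "f j" "f x" "f i"] by auto
      then show False using i j by auto
    qed
    then show ?thesis by blast
  qed (use i in auto)
qed

text \<open>\<open>RB\<close> compares only neighbouring entries. Intervals are glued with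
  \<open>S_compose\<close> by induction on the upper index, and pairs in descending order have empty
  sets on both sides.\<close>

lemma match_increasing:
  assumes inc: "increasing lt M as" "increasing lt M bs" and len: "length as = length bs"
    and tp: "\<And>i. i < length as \<Longrightarrow> tp L M [as ! i] = tp L M [bs ! i]"
    and S: "\<And>i. Suc i < length as \<Longrightarrow> S (as ! i) (as ! Suc i) = S (bs ! i) (bs ! Suc i)"
  shows "match as bs"
proof -
  have U: "as ! i \<in> U" "bs ! i \<in> U" if "i < length as" for i
    using inc that len by (auto simp: increasing_def)
  have less: "as ! i \<sqsubset> as ! j" "bs ! i \<sqsubset> bs ! j" if "i < j" "j < length as" for i j
    using inc that len by (auto simp: increasing_def sorted_wrt_iff_nth_less)
  have up: "S (bs ! i) (bs ! j) = S (as ! i) (as ! j)" if "i < j" "j < length as" for i j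
    using that
  proof (induction j)
    case (Suc j)
    show ?case
    proof (cases "i = j")
      case True
      then show ?thesis using S Suc.prems by simp
    next
      case False
      then have ij: "i < j" "j < length as" "i < length as" using Suc.prems by auto
      show ?thesis
        by (rule S_compose[OF less(1)[OF ij(1,2)] less(1)[OF lessI Suc.prems(2)]
              U(1)[OF ij(3)] U(1)[OF ij(2)] U(1)[OF Suc.prems(2)] Suc.IH[OF ij(1,2)]
              S[OF Suc.prems(2), symmetric] tp[OF ij(2), symmetric]])
    qed
  qed simp
  have "S (as ! i) (as ! j) = S (bs ! i) (bs ! j)" if "i < length as" "j < length as" for i j
  proof (cases i j rule: linorder_cases)
    case greater
    then show ?thesis using less that S_asym by simp
  qed (use up that S_refl in auto)
  then show ?thesis using inc len tp by (auto simp: match_def increasing_def)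
qed

lemma exists_sorted:
  assumes "finite A" "A \<subseteq> U"
  shows "\<exists>xs. set xs = A \<and> increasing lt M xs"
  using assms
proof (induction A)
  case (insert x A)
  then obtain xs where xs: "set xs = A" "sorted_wrt (\<sqsubset>) xs"
    by (auto simp: increasing_def)
  let ?ys = "filter (\<lambda>y. y \<sqsubset> x) xs @ [x] @ filter (\<lambda>y. x \<sqsubset> y) xs"
  have "set ?ys = insert x A"
    using insert.hyps insert.prems xs(1) less_linear by auto
  moreover have "sorted_wrt (\<sqsubset>) ?ys"
    using xs insert.prems less_trans
    by (auto simp: sorted_wrt_append sorted_wrt_filter)
  ultimately show ?case using insert.prems unfolding increasing_def by metis
qed (auto simp: increasing_def)

text \<open>A tuple is obtained by renaming variables from the increasing enumeration of its entries.\<close>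

lemma match_imp_tp_eq:
  assumes inc: "\<And>as bs. increasing lt M as \<Longrightarrow> increasing lt M bs \<Longrightarrow> match as bs \<Longrightarrow>
      tp L M as = tp L M bs"
    and m: "match as bs"
  shows "tp L M as = tp L M bs"
proof -
  have len: "length as = length bs" and asU: "set as \<subseteq> U" and bsU: "set bs \<subseteq> U"
    using m by (auto simp: match_def)
  obtain xs where xs: "set xs = set as" "increasing lt M xs"
    using exists_sorted[of "set as"] asU by auto
  have "\<forall>x\<in>set xs. \<exists>i. i < length as \<and> as ! i = x"
    unfolding xs(1) by (simp add: in_set_conv_nth)
  then obtain k where k: "\<forall>x\<in>set xs. k x < length as \<and> as ! k x = x" by metis
  have "\<forall>i<length as. \<exists>j. j < length xs \<and> xs ! j = as ! i"
    using xs(1) by (metis in_set_conv_nth)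
  then obtain p where p: "\<forall>i<length as. p i < length xs \<and> xs ! p i = as ! i" by metis
  define ks where "ks = map k xs"
  define ys where "ys = map ((!) bs) ks"
  have xs_ks: "xs = map ((!) as) ks" using k by (simp add: ks_def map_idI)
  have ks: "\<And>i. i \<in> set ks \<Longrightarrow> i < length as" using k by (auto simp: ks_def)
  have lys: "length ys = length xs" by (simp add: ys_def ks_def)
  have mxy: "match xs ys"
    unfolding xs_ks ys_def using m ks len
    by (auto simp: match_def subset_iff)
  have "increasing lt M ys"
    using xs(2) mxy match_less[OF mxy] lys
    by (auto simp: increasing_def match_def sorted_wrt_iff_nth_less)
  then have eq: "tp L M xs = tp L M ys" using inc xs(2) mxy by blast
  have "as = map ((!) xs) (map p [0..<length as])"
    using p by (intro nth_equalityI) auto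
  moreover have "bs = map ((!) ys) (map p [0..<length as])"
  proof (intro nth_equalityI)
    fix i assume i: "i < length bs"
    then have i': "i < length as" "p i < length xs" using len p by auto
    have "xs ! p i \<in> set xs" using i'(2) by simp
    \<comment> \<open>The position chosen for an entry need not be the position it came from. Both
      carry the same entry of \<open>as\<close>, and \<open>match_eq\<close> carries this
      coincidence over to \<open>bs\<close>.\<close>
    then have "as ! k (xs ! p i) = xs ! p i" using k by blast
    then have "as ! (ks ! p i) = as ! i"
      using p i' by (simp add: ks_def)
    moreover have "ks ! p i < length as" using ks i' by (simp add: ks_def)
    ultimately have "bs ! (ks ! p i) = bs ! i" using match_eq[OF m] i' by blast
    then show "bs ! i = map ((!) ys) (map p [0..<length as]) ! i"
      using i' by (simp add: ys_def ks_def)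
  qed (simp add: len)
  moreover have "\<And>i. i \<in> set (map p [0..<length as]) \<Longrightarrow> i < length xs" using p by auto
  ultimately show ?thesis
    using tp_eq_sub[OF eq lys[symmetric], of "map p [0..<length as]"] by metis
qed

end

context saturated_linear_struct
begin

text \<open>A new entry falls into one gap of \<open>as\<close>. It is enough to choose
  \<open>d\<close> correctly relative to the nearest entries, because \<open>S_compose\<close>
  propagates the agreement to all remaining ones.\<close>

lemma extend_match:
  assumes m: "match as bs" and c: "c \<in> U"
  shows "\<exists>d\<in>U. match (c # as) (d # bs)"
proof (cases "c \<in> set as")
  case True
  then obtain i where i: "i < length as" "c = as ! i" by (auto simp: in_set_conv_nth)
  then have "match (c # as) (bs ! i # bs)"
    using m c by (intro match_ConsI) (auto simp: match_def)
  then show ?thesis using i m by (auto simp: match_def)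
next
  case False
  have U: "as ! i \<in> U" "bs ! i \<in> U" and tp: "tp L M [bs ! i] = tp L M [as ! i]"
    if "i < length as" for i
    using m that by (auto simp: match_def)
  have S: "S (bs ! i) (bs ! j) = S (as ! i) (as ! j)" if "i < length as" "j < length as" for i j
    using m that by (auto simp: match_def)
  define I where "I = {i. i < length as \<and> as ! i \<sqsubset> c}"
  define J where "J = {i. i < length as \<and> c \<sqsubset> as ! i}"
  have IJ: "i \<in> I \<or> i \<in> J" if "i < length as" for i
    using less_linear[OF c U(1)[OF that]] that False by (auto simp: I_def J_def)
  have fin: "finite I" "finite J" by (auto simp: I_def J_def)
  have imU: "(!) as ` I \<subseteq> U" "(!) as ` J \<subseteq> U" using U by (auto simp: I_def J_def)
  define lower where "lower i \<longleftrightarrow> i \<in> I \<and> (\<forall>k\<in>I. \<not> as ! i \<sqsubset> as ! k)" for i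
  define upper where "upper j \<longleftrightarrow> j \<in> J \<and> (\<forall>k\<in>J. \<not> as ! k \<sqsubset> as ! j)" for j
  have lower: "\<exists>i. lower i" if "I \<noteq> {}"
    using exists_maximal[OF fin(1) that imU(1)] by (auto simp: lower_def)
  have upper: "\<exists>j. upper j" if "J \<noteq> {}"
    using exists_minimal[OF fin(2) that imU(2)] by (auto simp: upper_def)
  have suff: "match (c # as) (d # bs)"
    if d: "d \<in> U" "tp L M [d] = tp L M [c]"
      and lo: "I \<noteq> {} \<Longrightarrow> \<exists>i. lower i \<and> S (bs ! i) d = S (as ! i) c"
      and up: "J \<noteq> {} \<Longrightarrow> \<exists>j. upper j \<and> S d (bs ! j) = S c (as ! j)" for d
  proof -
    have I: "S (bs ! k) d = S (as ! k) c" if k: "k \<in> I" for k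
    proof -
      obtain i where i: "lower i" "S (bs ! i) d = S (as ! i) c" using lo k by blast
      have len: "i < length as" "k < length as" using i k by (auto simp: lower_def I_def)
      have "\<not> as ! i \<sqsubset> as ! k" "as ! i \<sqsubset> c" using i k by (auto simp: lower_def I_def)
      then consider "as ! k = as ! i" | "as ! k \<sqsubset> as ! i"
        using less_linear[OF U(1) U(1)] len by blast
      then show ?thesis
      proof cases
        case 1
        then show ?thesis using i(2) match_eq[OF m len(2,1)] by simp
      next
        case 2
        then show ?thesis
          using i(2) S tp len U c \<open>as ! i \<sqsubset> c\<close>
          by (intro S_compose[of "as ! k" "as ! i" c "bs ! k" "bs ! i" d]) auto
      qed
    qed
    have J: "S d (bs ! k) = S c (as ! k)" if k: "k \<in> J" for k
    proof -
      obtain j where j: "upper j" "S d (bs ! j) = S c (as ! j)" using up k by blast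
      have len: "j < length as" "k < length as" using j k by (auto simp: upper_def J_def)
      have "\<not> as ! k \<sqsubset> as ! j" "c \<sqsubset> as ! j" using j k by (auto simp: upper_def J_def)
      then consider "as ! k = as ! j" | "as ! j \<sqsubset> as ! k"
        using less_linear[OF U(1) U(1)] len by blast
      then show ?thesis
      proof cases
        case 1
        then show ?thesis using j(2) match_eq[OF m len(2,1)] by simp
      next
        case 2
        then show ?thesis
          using j(2) S tp len U c \<open>c \<sqsubset> as ! j\<close>
          by (intro S_compose[of c "as ! j" "as ! k" d "bs ! j" "bs ! k"]) auto
      qed
    qed
    \<comment> \<open>An entry is only controlled in the direction in which it lies from
      \<open>c\<close>. That direction fixes the order on the other side as well, so both sets in
      the reverse direction are empty.\<close>
    have flip: "S y x = {}" if "S x' y' = S x y" "x' \<sqsubset> y'" "x' \<in> U" "y' \<in> U" for x y x' y'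
      using that S_asym Nil_in_S by metis
    show ?thesis
    proof (rule match_ConsI[OF m c d])
      fix k assume k: "k < length as"
      show "S (bs ! k) d = S (as ! k) c"
      proof (cases "k \<in> I")
        case False
        then have "k \<in> J" using IJ k by blast
        then show ?thesis
          using flip[OF J[symmetric]] S_asym U[OF k] c by (simp add: J_def)
      qed (rule I)
      show "S d (bs ! k) = S c (as ! k)"
      proof (cases "k \<in> J")
        case False
        then have "k \<in> I" using IJ k by blast
        then show ?thesis
          using flip[OF I[symmetric]] S_asym U[OF k] c by (simp add: I_def)
      qed (rule J)
    qed
  qed
  have Ilen: "i < length as" "as ! i \<sqsubset> c" if "lower i" for i
    using that by (auto simp: lower_def I_def)
  have Jlen: "j < length as" "c \<sqsubset> as ! j" if "upper j" for j
    using that by (auto simp: upper_def J_def)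
  show ?thesis
  proof (cases "I = {}"; cases "J = {}")
    assume "I = {}" "J = {}"
    \<comment> \<open>With no entry on either side of \<open>c\<close> both tuples are empty, and
      \<open>c\<close> can be matched with itself.\<close>
    then have "match (c # as) (c # bs)" using c by (intro suff) auto
    then show ?thesis using c by blast
  next
    assume IJ: "I = {}" "J \<noteq> {}"
    then obtain j where j: "upper j" using upper by blast
    obtain d where "d \<in> U" "tp L M [d] = tp L M [c]" "S d (bs ! j) = S c (as ! j)"
      using exists_right[OF tp U c, of j] Jlen[OF j] by metis
    then show ?thesis using suff[of d] IJ j by blast
  next
    assume IJ: "I \<noteq> {}" "J = {}"
    then obtain i where i: "lower i" using lower by blast
    obtain d where "d \<in> U" "tp L M [d] = tp L M [c]" "S (bs ! i) d = S (as ! i) c"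
      using exists_right[OF tp U c, of i] Ilen[OF i] by metis
    then show ?thesis using suff[of d] IJ i by blast
  next
    assume IJ: "I \<noteq> {}" "J \<noteq> {}"
    then obtain i j where i: "lower i" and j: "upper j" using lower upper by blast
    obtain d where "d \<in> U" "tp L M [d] = tp L M [c]" "S (bs ! i) d = S (as ! i) c"
      "S d (bs ! j) = S c (as ! j)"
      using back_and_forth_between[OF S _ _ c _ _ tp tp, of i j] Ilen[OF i] Jlen[OF j] U by metis
    then show ?thesis using suff[of d] i j by blast
  qed
qed

end

section \<open>Colored orders\<close>

lemma colored_fm_induct [consumes 2, case_names Eq less color Neg Conj Exi]:
  assumes co: "colored_order K lt C" and \<psi>: "\<psi> \<in> formulas K n"
    and Eq: "\<And>n i j. i < n \<Longrightarrow> j < n \<Longrightarrow> P n (Eq (Var i) (Var j))"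
    and less: "\<And>n i j. i < n \<Longrightarrow> j < n \<Longrightarrow> P n (Rel lt [Var i, Var j])"
    and color: "\<And>n c i. (c, 1) \<in> rels K \<Longrightarrow> i < n \<Longrightarrow> P n (Rel c [Var i])"
    and Neg: "\<And>n \<psi>. \<psi> \<in> formulas K n \<Longrightarrow> P n \<psi> \<Longrightarrow> P n (Neg \<psi>)"
    and Conj: "\<And>n \<psi> \<chi>. \<psi> \<in> formulas K n \<Longrightarrow> \<chi> \<in> formulas K n \<Longrightarrow> P n \<psi> \<Longrightarrow> P n \<chi> \<Longrightarrow>
      P n (Conj \<psi> \<chi>)"
    and Exi: "\<And>n \<psi>. \<psi> \<in> formulas K (Suc n) \<Longrightarrow> P (Suc n) \<psi> \<Longrightarrow> P n (Exi \<psi>)"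
  shows "P n \<psi>"
  using \<psi>
proof (induction \<psi> arbitrary: n)
  have tm: "\<exists>i. t = Var i" if "wf_tm K t" for t
    using that co by (cases t) (auto simp: colored_order_def)
  {
    case (Eq t u)
    then obtain i j where ij: "t = Var i" "u = Var j"
      using tm[of t] tm[of u] by (auto simp: formulas_def)
    show ?case using Eq assms(3) unfolding ij by simp
  next
    case (Rel r ts)
    then have r: "(r, length ts) \<in> rels K" and ts: "\<forall>t\<in>set ts. \<exists>i. t = Var i"
      using tm by (auto simp: formulas_def list_all_iff)
    from r co consider "r = lt" "length ts = 2" | "length ts = 1"
      by (auto simp: colored_order_def)
    then show ?case
    proof cases
      case 1
      then obtain t u where "ts = [t, u]" by (auto simp: numeral_2_eq_2 length_Suc_conv)
      then obtain i j where "ts = [Var i, Var j]" using ts by auto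
      then show ?thesis using 1 Rel less by simp
    next
      case 2
      then obtain t where "ts = [t]" by (auto simp: length_Suc_conv)
      then obtain i where "ts = [Var i]" using ts by auto
      then show ?thesis using Rel color by simp
    qed
  }
qed (simp_all add: Neg Conj Exi)

context saturated_linear_struct
begin

text \<open>In the colored order this is the Ehrenfeucht-Fraisse induction, with
  \<open>extend_match\<close> supplying the quantifier step in both directions. A formula of
  \<open>L\<close> is then replaced by a colored formula defining the same set.\<close>

lemma match_imp_tp_eq_of_equiv:
  assumes co: "colored_order K lt' C"
    and less: "\<And>x y. x \<in> U \<Longrightarrow> y \<in> U \<Longrightarrow> less_in lt' C x y \<longleftrightarrow> x \<sqsubset> y"
    and eqv: "definitionally_equivalent L M K C"
    and m: "match as bs"
  shows "tp L M as = tp L M bs"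
proof (rule tp_eqI)
  have CU: "universe C = U" and dfn: "definable L M n X \<longleftrightarrow> definable K C n X" for n X
    using eqv by (auto simp: definitionally_equivalent_def)
  have K: "holds C as \<psi> \<longleftrightarrow> holds C bs \<psi>"
    if "\<psi> \<in> formulas K n" "match as bs" "length as = n" for \<psi> n as bs
    using co that
  proof (induction arbitrary: as bs rule: colored_fm_induct)
    case (Eq n i j)
    then show ?case using match_eq by simp
  next
    case (less n i j)
    then have "as ! i \<in> U" "as ! j \<in> U" "bs ! i \<in> U" "bs ! j \<in> U"
      by (auto simp: match_def)
    then show ?case using less match_less assms(2) by simp
  next
    case (color n p i)
    \<comment> \<open>A color is a definable unary set, hence given by a formula of
      \<open>L\<close>, and equality of 1-types preserves it.\<close>
    have "definable K C 1 {xs. length xs = 1 \<and> set xs \<subseteq> U \<and> holds C xs (Rel p [Var 0])}"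
      unfolding definable_def CU using color by (intro bexI[of _ "Rel p [Var 0]"]) auto
    then have "definable L M 1 {xs. length xs = 1 \<and> set xs \<subseteq> U \<and> holds C xs (Rel p [Var 0])}"
      by (simp only: dfn)
    then obtain \<phi> where \<phi>: "\<phi> \<in> formulas L 1"
      and eq: "{xs. length xs = 1 \<and> set xs \<subseteq> U \<and> holds C xs (Rel p [Var 0])} =
        {xs. length xs = 1 \<and> set xs \<subseteq> U \<and> holds M xs \<phi>}"
      unfolding definable_def by blast
    have "relI C p [x] \<longleftrightarrow> holds M [x] \<phi>" if "x \<in> U" for x
      using arg_cong[OF eq, of "\<lambda>X. [x] \<in> X"] that by simp
    moreover have "holds M [as ! i] \<phi> = holds M [bs ! i] \<phi>"
      using color \<phi> by (intro tp_eqD[of L]) (auto simp: match_def)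
    moreover have "as ! i \<in> U" "bs ! i \<in> U" using color by (auto simp: match_def)
    ultimately show ?case by simp
  next
    case (Exi n \<psi>)
    have sym: "match bs as" using Exi.prems by (auto simp: match_def)
    have len: "length bs = n" using Exi.prems by (simp add: match_def)
    show ?case
    proof
      assume "holds C as (Exi \<psi>)"
      then obtain c where "c \<in> U" "holds C (c # as) \<psi>" by (auto simp: CU)
      then show "holds C bs (Exi \<psi>)"
        using extend_match[OF Exi.prems(1)] Exi.IH Exi.prems by (fastforce simp: CU)
    next
      assume "holds C bs (Exi \<psi>)"
      then obtain c where "c \<in> U" "holds C (c # bs) \<psi>" by (auto simp: CU)
      then show "holds C as (Exi \<psi>)"
        using extend_match[OF sym] Exi.IH len by (fastforce simp: CU)
    qed
  qed simp_all
  show len: "length as = length bs" using m by (simp add: match_def)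
  fix \<phi> assume \<phi>: "\<phi> \<in> formulas L (length as)"
  let ?X = "{xs. length xs = length as \<and> set xs \<subseteq> U \<and> holds M xs \<phi>}"
  have "definable L M (length as) ?X" using \<phi> by (auto simp: definable_def)
  then have "definable K C (length as) ?X" by (simp only: dfn)
  then obtain \<psi> where \<psi>: "\<psi> \<in> formulas K (length as)"
    and eq: "?X = {xs. length xs = length as \<and> set xs \<subseteq> U \<and> holds C xs \<psi>}"
    unfolding definable_def CU by blast
  have "holds M xs \<phi> \<longleftrightarrow> holds C xs \<psi>" if "length xs = length as" "set xs \<subseteq> U" for xs
    using arg_cong[OF eq, of "\<lambda>X. xs \<in> X"] that by simp
  moreover have "set as \<subseteq> U" "set bs \<subseteq> U" using m by (auto simp: match_def)
  ultimately show "holds M as \<phi> = holds M bs \<phi>"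
    using K[OF \<psi> m] len by metis
qed

end

section \<open>Transfer between models\<close>

text \<open>Expressing realized sequences by \<open>btw\<close> relies on transitivity. As a
  sentence it belongs to the complete theory and passes to every model.\<close>

definition transp_fm :: "'r \<Rightarrow> ('f, 'r) fm" where
  "transp_fm lt = Neg (Exi (Exi (Exi (Conj (Rel lt [Var 2, Var 1])
    (Conj (Rel lt [Var 1, Var 0]) (Neg (Rel lt [Var 2, Var 0])))))))"

lemma holds_transp_fm: "holds M [] (transp_fm lt) \<longleftrightarrow> transp_on (universe M) (less_in lt M)"
  by (auto simp: transp_fm_def transp_on_def)

lemma transp_of_model:
  assumes M: "linearly_ordered L lt M" and N: "is_model L (complete_theory L M) N"
  shows "transp_on (universe N) (less_in lt N)"
proof -
  have "transp_fm lt \<in> complete_theory L M"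
    using M by (simp add: complete_theory_def holds_transp_fm linearly_ordered_def)
      (simp add: transp_fm_def)
  then show ?thesis
    using N by (simp add: is_model_def flip: holds_transp_fm)
qed

text \<open>The type of the empty tuple is the theory itself, which decides every sentence. It is
  the starting point for realizing tuples entry by entry.\<close>

lemma tp_Nil_of_model:
  assumes N: "is_model L (complete_theory L M) N"
  shows "tp L M [] = tp L N []"
proof (rule tp_eqI)
  fix \<phi> assume \<phi>: "\<phi> \<in> formulas L (length [])"
  have "\<psi> \<in> formulas L 0 \<Longrightarrow> holds M [] \<psi> \<Longrightarrow> holds N [] \<psi>" for \<psi>
    using N by (simp add: is_model_def complete_theory_def)
  from this[of \<phi>] this[of "Neg \<phi>"] show "holds M [] \<phi> = holds N [] \<phi>"
    using \<phi> by auto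
qed simp

lemma tp_eq_nth:
  assumes "tp L M xs = tp L N ys" "length xs = length ys" "i < length xs"
  shows "tp L M [xs ! i] = tp L N [ys ! i]"
  using tp_eq_sub[OF assms(1,2), of "[i]"] assms(3) by simp

lemma tp_eq_rseqs:
  assumes "transp_on (universe M) (less_in lt M)" "transp_on (universe N) (less_in lt N)"
    and "(lt, 2) \<in> rels L" "set xs \<subseteq> universe M" "set ys \<subseteq> universe N"
    and "tp L M xs = tp L N ys" "length xs = length ys" "i < length xs" "j < length xs"
  shows "rseqs L lt M (xs ! i) (xs ! j) = rseqs L lt N (ys ! i) (ys ! j)"
proof (rule rseqs_eq_of_tp_eq[OF assms(1-3)])
  show "tp L M [xs ! i, xs ! j] = tp L N [ys ! i, ys ! j]"
    using tp_eq_sub[OF assms(6,7), of "[i, j]"] assms(8,9) by auto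
qed (use assms in auto)

context saturated_linear_struct
begin

text \<open>Adding entries one at a time with \<open>extend_tp\<close> shows that \<open>M\<close>
  realizes the type of every finite tuple from a model of its theory.\<close>

lemma exists_tp_eq:
  fixes N :: "('f, 'r, 'b) struct"
  assumes "is_model L (complete_theory L M) N" "set xs \<subseteq> universe N"
  shows "\<exists>xs'. length xs' = length xs \<and> set xs' \<subseteq> U \<and> tp L M xs' = tp L N xs"
  using assms(2)
proof (induction xs)
  case Nil
  then show ?case using tp_Nil_of_model[OF assms(1)] by simp
next
  case (Cons x xs)
  then obtain xs' where "length xs' = length xs" "set xs' \<subseteq> U" "tp L M xs' = tp L N xs" by auto
  moreover from this obtain x' where "x' \<in> U" "tp L M (x' # xs') = tp L N (x # xs)"
    using extend_tp[of xs' N xs x] Cons.prems by auto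
  ultimately have "length (x' # xs') = length (x # xs) \<and> set (x' # xs') \<subseteq> U \<and>
    tp L M (x' # xs') = tp L N (x # xs)" by simp
  then show ?case by blast
qed

lemma increasing_tp_eq:
  assumes "tp L M xs' = tp L N xs" "length xs' = length xs" "set xs' \<subseteq> U" "increasing lt N xs"
  shows "increasing lt M xs'"
proof -
  have "less_in lt M (xs' ! i) (xs' ! j)" if "i < j" "j < length xs'" for i j
  proof -
    have "Rel lt [Var i, Var j] \<in> formulas L (length xs')"
      using that lt_in_rels by simp
    from tp_eqD[OF assms(1,2) this] show ?thesis
      using that assms(2,4) by (simp add: increasing_def sorted_wrt_iff_nth_less)
  qed
  then show ?thesis using assms(3) by (simp add: increasing_def sorted_wrt_iff_nth_less)
qed

text \<open>Both tuples have copies of the same types in \<open>M\<close>. Order, 1-types and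
  realized sequences can all be read off from types, so the copies match, and equality of their
  types is equality of the original ones.\<close>

lemma RB_of_match:
  assumes m: "\<And>as bs. match as bs \<Longrightarrow> tp L M as = tp L M bs"
  shows "RB TYPE('u) L lt M"
  unfolding RB_def rseqs_eq_iff[symmetric]
proof (intro allI impI iffI)
  fix N N' :: "('f, 'r, 'u) struct" and as bs
  assume N: "is_model L (complete_theory L M) N" and N': "is_model L (complete_theory L M) N'"
    and inc: "increasing lt N as" "increasing lt N' bs" and len: "length as = length bs"
  have U: "set as \<subseteq> universe N" "set bs \<subseteq> universe N'"
    using inc by (auto simp: increasing_def)
  note tN = transp_of_model[OF linear N] and tN' = transp_of_model[OF linear N']
  {
    assume eq: "tp L N as = tp L N' bs"
    show "(\<forall>i<length as. tp L N [as ! i] = tp L N' [bs ! i]) \<and>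
      (\<forall>i. Suc i < length as \<longrightarrow>
        rseqs L lt N (as ! i) (as ! Suc i) = rseqs L lt N' (bs ! i) (bs ! Suc i))"
      using tp_eq_nth[OF eq len] tp_eq_rseqs[OF tN tN' lt_in_rels U eq len] by simp
  next
    assume *: "(\<forall>i<length as. tp L N [as ! i] = tp L N' [bs ! i]) \<and>
      (\<forall>i. Suc i < length as \<longrightarrow>
        rseqs L lt N (as ! i) (as ! Suc i) = rseqs L lt N' (bs ! i) (bs ! Suc i))"
    obtain as' where as': "length as' = length as" "set as' \<subseteq> U" "tp L M as' = tp L N as"
      using exists_tp_eq[OF N U(1)] by blast
    obtain bs' where bs': "length bs' = length bs" "set bs' \<subseteq> U" "tp L M bs' = tp L N' bs"
      using exists_tp_eq[OF N' U(2)] by blast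
    have "match as' bs'"
    proof (rule match_increasing)
      show "increasing lt M as'" "increasing lt M bs'"
        using increasing_tp_eq as' bs' inc by blast+
      show "length as' = length bs'" using as' bs' len by simp
    next
      fix i assume "i < length as'"
      then show "tp L M [as' ! i] = tp L M [bs' ! i]"
        using * as' bs' len tp_eq_nth[OF as'(3,1), of i] tp_eq_nth[OF bs'(3,1), of i] by simp
    next
      fix i assume "Suc i < length as'"
      then show "S (as' ! i) (as' ! Suc i) = S (bs' ! i) (bs' ! Suc i)"
        using * as'(1) bs'(1) len
          tp_eq_rseqs[OF transp tN lt_in_rels as'(2) U(1) as'(3,1), of i "Suc i"]
          tp_eq_rseqs[OF transp tN' lt_in_rels bs'(2) U(2) bs'(3,1), of i "Suc i"]
        by simp
    qed
    then show "tp L N as = tp L N' bs" using m as'(3) bs'(3) by simp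
  }
qed

end

context linear_struct
begin

text \<open>One small elementary copy \<open>N\<close> contains both tuples, so \<open>RB\<close> is
  applied with \<open>N\<close> in both roles. The formulas \<open>btw\<close> make its realized
  sequences those of \<open>M\<close>.\<close>

lemma tp_eq_of_RB:
  assumes rb: "RB TYPE('u) L lt M" and le: "{\<phi>. wf_fm L \<phi>} \<lesssim> (UNIV :: 'u set)"
    and inc: "increasing lt M as" "increasing lt M bs" and m: "match as bs"
  shows "tp L M as = tp L M bs"
proof -
  have M: "is_struct L M" using linear by (simp add: linearly_ordered_def)
  let ?A = "set as \<union> set bs"
  have AU: "?A \<subseteq> U" and len: "length as = length bs" using m by (auto simp: match_def)
  obtain N :: "('f, 'r, 'u) struct" and f where N: "is_struct L N" "f ` ?A \<subseteq> universe N"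
    and el: "\<And>xs \<phi>. set xs \<subseteq> ?A \<Longrightarrow> \<phi> \<in> formulas L (length xs) \<Longrightarrow>
      holds N (map f xs) \<phi> = holds M xs \<phi>"
    using small_elementary_copy[OF M AU _ le] by (metis finite_Un finite_set)
  have mod: "is_model L (complete_theory L M) N"
    using N(1) el[of "[]"] by (simp add: is_model_def complete_theory_def)
  note tN = transp_of_model[OF linear mod]
  have tp: "tp L N (map f xs) = tp L M xs" if "set xs \<subseteq> ?A" for xs
    using el[OF that] by (intro tp_eqI) auto
  have less: "less_in lt N (f a) (f b) \<longleftrightarrow> a \<sqsubset> b" if "a \<in> ?A" "b \<in> ?A" for a b
    using el[of "[a, b]" "Rel lt [Var 0, Var 1]"] that lt_in_rels by simp
  have incN: "increasing lt N (map f xs)" if "increasing lt M xs" "set xs \<subseteq> ?A" for xs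
    using that N(2) less
    by (auto simp: increasing_def sorted_wrt_iff_nth_less subset_iff)
  have rs: "rseqs L lt N (f a) (f b) = S a b" if "a \<in> ?A" "b \<in> ?A" for a b
    using tp[of "[a, b]"] that N(2) AU
    by (intro rseqs_eq_of_tp_eq[OF tN transp lt_in_rels]) auto
  have "tp L N (map f as) = tp L N (map f bs)"
  proof -
    have "tp L N [map f as ! i] = tp L N [map f bs ! i]" if "i < length as" for i
      using that tp[of "[as ! i]"] tp[of "[bs ! i]"] m by (auto simp: match_def)
    moreover have "rseqs L lt N (map f as ! i) (map f as ! Suc i) =
        rseqs L lt N (map f bs ! i) (map f bs ! Suc i)" if "Suc i < length as" for i
      using that rs len m by (simp add: match_def)
    ultimately show ?thesis
      using rb[unfolded RB_def rseqs_eq_iff[symmetric], rule_format,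
          OF mod mod incN[OF inc(1)] incN[OF inc(2)]] len by simp
  qed
  then show ?thesis using tp[of as] tp[of bs] by simp
qed

end

section \<open>Definability from the colors\<close>

text \<open>A set closed under agreement on finitely many formulas is a union of agreement classes,
  hence a Boolean combination of these formulas. Induction on \<open>G\<close> avoids writing out a
  disjunctive normal form.\<close>

lemma definable_of_invariant:
  assumes "finite G" "G \<subseteq> formulas K n"
    and "X \<subseteq> {xs. length xs = n \<and> set xs \<subseteq> universe C}"
    and "\<And>xs ys. xs \<in> X \<Longrightarrow> length ys = n \<Longrightarrow> set ys \<subseteq> universe C \<Longrightarrow>
      (\<And>\<psi>. \<psi> \<in> G \<Longrightarrow> holds C xs \<psi> \<longleftrightarrow> holds C ys \<psi>) \<Longrightarrow> ys \<in> X"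
  shows "definable K C n X"
  using assms
proof (induction G arbitrary: X)
  case empty
  show ?case
  proof (cases "X = {}")
    case True
    then show ?thesis unfolding definable_def by (intro bexI[of _ "Neg (conjs [])"]) auto
  next
    case False
    then obtain xs where "xs \<in> X" by blast
    then have "X = {xs. length xs = n \<and> set xs \<subseteq> universe C}"
      using empty.prems(2) empty.prems(3)[of xs] by blast
    then show ?thesis unfolding definable_def by (intro bexI[of _ "conjs []"]) auto
  qed
next
  case (insert \<psi> G)
  let ?T = "{xs. length xs = n \<and> set xs \<subseteq> universe C}"
  \<comment> \<open>For each truth value \<open>b\<close>, this closes the part of \<open>X\<close>
    on which \<open>\<psi>\<close> has value \<open>b\<close> under agreement on the smaller set
    \<open>G\<close>.\<close>
  define Y where "Y b = {ys \<in> ?T. \<exists>xs\<in>X. (holds C xs \<psi> \<longleftrightarrow> b) \<and>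
    (\<forall>\<chi>\<in>G. holds C xs \<chi> \<longleftrightarrow> holds C ys \<chi>)}" for b
  have "definable K C n (Y b)" for b
  proof (rule insert.IH)
    fix xs ys assume "xs \<in> Y b" "length ys = n" "set ys \<subseteq> universe C"
      "\<And>\<psi>. \<psi> \<in> G \<Longrightarrow> holds C xs \<psi> \<longleftrightarrow> holds C ys \<psi>"
    then show "ys \<in> Y b" by (auto simp: Y_def)
  qed (use insert.prems in \<open>auto simp: Y_def\<close>)
  then have "\<forall>b. \<exists>\<chi>. \<chi> \<in> formulas K n \<and>
      Y b = {xs. length xs = n \<and> set xs \<subseteq> universe C \<and> holds C xs \<chi>}"
    unfolding definable_def by blast
  then obtain \<chi> where \<chi>: "\<And>b. \<chi> b \<in> formulas K n"
      "\<And>b. Y b = {xs. length xs = n \<and> set xs \<subseteq> universe C \<and> holds C xs (\<chi> b)}"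
    by (auto dest!: choice)
  have X: "ys \<in> X \<longleftrightarrow> ys \<in> Y (holds C ys \<psi>)" if ys: "ys \<in> ?T" for ys
  proof
    assume "ys \<in> X"
    then show "ys \<in> Y (holds C ys \<psi>)" using ys by (auto simp: Y_def)
  next
    assume "ys \<in> Y (holds C ys \<psi>)"
    then obtain xs where "xs \<in> X" "holds C xs \<psi> \<longleftrightarrow> holds C ys \<psi>"
      "\<forall>\<chi>\<in>G. holds C xs \<chi> \<longleftrightarrow> holds C ys \<chi>" by (auto simp: Y_def)
    then show "ys \<in> X" using insert.prems(3)[of xs ys] ys by blast
  qed
  \<comment> \<open>This says that \<open>\<psi>\<close> implies \<open>\<chi> True\<close> and its
    negation implies \<open>\<chi> False\<close>: a definition by cases on
    \<open>\<psi>\<close>.\<close>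
  let ?\<phi> = "Conj (Neg (Conj \<psi> (Neg (\<chi> True)))) (Neg (Conj (Neg \<psi>) (Neg (\<chi> False))))"
  have "xs \<in> X \<longleftrightarrow> holds C xs ?\<phi>" if "xs \<in> ?T" for xs
    using X[OF that] \<chi>(2) that by (cases "holds C xs \<psi>") auto
  then have "X = {xs. length xs = n \<and> set xs \<subseteq> universe C \<and> holds C xs ?\<phi>}"
    using insert.prems(2) by blast
  moreover have "?\<phi> \<in> formulas K n" using \<chi>(1) insert.prems(1) by simp
  ultimately show ?case unfolding definable_def by blast
qed

context saturated_linear_struct
begin

text \<open>Quantifying out index 0 from all finite conjunctions leaves a finitely satisfiable set
  in one variable fewer. A tuple realizing it serves as the parameters over which saturation finds
  the missing entry.\<close>

lemma realize_tuple:
  assumes "\<Phi> \<subseteq> formulas L n"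
    and "\<And>\<Psi>. \<Psi> \<subseteq> \<Phi> \<Longrightarrow> finite \<Psi> \<Longrightarrow>
      \<exists>xs. length xs = n \<and> set xs \<subseteq> U \<and> (\<forall>\<phi>\<in>\<Psi>. holds M xs \<phi>)"
  shows "\<exists>xs. length xs = n \<and> set xs \<subseteq> U \<and> (\<forall>\<phi>\<in>\<Phi>. holds M xs \<phi>)"
  using assms
proof (induction n arbitrary: \<Phi>)
  case 0
  have "holds M [] \<phi>" if "\<phi> \<in> \<Phi>" for \<phi>
    using 0(2)[of "{\<phi>}"] that by auto
  then show ?case by simp
next
  case (Suc n)
  let ?e = "\<lambda>\<psi>s. Exi (conjs \<psi>s)"
  let ?\<Phi>' = "?e ` {\<psi>s. set \<psi>s \<subseteq> \<Phi>}"
  have "\<exists>xs. length xs = n \<and> set xs \<subseteq> U \<and> (\<forall>\<phi>\<in>?\<Phi>'. holds M xs \<phi>)"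
  proof (rule Suc.IH)
    show "?\<Phi>' \<subseteq> formulas L n" using Suc.prems(1) by auto
    fix \<Psi> assume "\<Psi> \<subseteq> ?\<Phi>'" "finite \<Psi>"
    then obtain G where G: "finite G" "G \<subseteq> {\<psi>s. set \<psi>s \<subseteq> \<Phi>}" "\<Psi> = ?e ` G"
      by (metis finite_subset_image)
    then have "(\<Union>\<psi>s\<in>G. set \<psi>s) \<subseteq> \<Phi>" "finite (\<Union>\<psi>s\<in>G. set \<psi>s)" by auto
    from Suc.prems(2)[OF this] obtain xs where xs: "length xs = Suc n" "set xs \<subseteq> U"
      "\<forall>\<phi>\<in>(\<Union>\<psi>s\<in>G. set \<psi>s). holds M xs \<phi>" by blast
    then obtain y ys where ys: "xs = y # ys" by (cases xs) auto
    have "\<forall>\<psi>s\<in>G. \<exists>c\<in>U. holds M (c # ys) (conjs \<psi>s)"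
      using xs unfolding ys by auto
    then show "\<exists>xs. length xs = n \<and> set xs \<subseteq> U \<and> (\<forall>\<phi>\<in>\<Psi>. holds M xs \<phi>)"
      using xs unfolding ys G(3) by (intro exI[of _ ys]) auto
  qed
  then obtain ys where ys: "length ys = n" "set ys \<subseteq> U" "\<forall>\<phi>\<in>?\<Phi>'. holds M ys \<phi>" by blast
  have "\<exists>c\<in>U. \<forall>\<phi>\<in>\<Phi>. holds M (c # ys) \<phi>"
  proof (rule realize)
    show "set ys \<subseteq> U" "\<Phi> \<subseteq> formulas L (Suc (length ys))" using ys Suc.prems by auto
    fix \<Psi> assume "\<Psi> \<subseteq> \<Phi>" "finite \<Psi>"
    then obtain \<psi>s where "set \<psi>s = \<Psi>" "set \<psi>s \<subseteq> \<Phi>" using finite_list by metis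
    moreover from this have "holds M ys (?e \<psi>s)" using ys(3) by blast
    ultimately show "\<exists>c\<in>U. \<forall>\<phi>\<in>\<Psi>. holds M (c # ys) \<phi>" by auto
  qed
  then obtain c where "c \<in> U" "\<forall>\<phi>\<in>\<Phi>. holds M (c # ys) \<phi>" by blast
  then show ?case using ys by (intro exI[of _ "c # ys"]) auto
qed

text \<open>Compactness in \<open>2 * n\<close> variables: the second tuple uses the variables from \<open>n\<close> on.\<close>

lemma finite_separation:
  assumes \<phi>: "\<phi> \<in> formulas L n" and \<Delta>: "\<Delta> \<subseteq> formulas L n"
    and sep: "\<And>xs ys. length xs = n \<Longrightarrow> length ys = n \<Longrightarrow> set xs \<subseteq> U \<Longrightarrow> set ys \<subseteq> U \<Longrightarrow>
      (\<And>\<delta>. \<delta> \<in> \<Delta> \<Longrightarrow> holds M xs \<delta> \<longleftrightarrow> holds M ys \<delta>) \<Longrightarrow> holds M xs \<phi> \<Longrightarrow> holds M ys \<phi>"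
  shows "\<exists>D. finite D \<and> D \<subseteq> \<Delta> \<and>
    (\<forall>xs ys. length xs = n \<longrightarrow> length ys = n \<longrightarrow> set xs \<subseteq> U \<longrightarrow> set ys \<subseteq> U \<longrightarrow>
      (\<forall>\<delta>\<in>D. holds M xs \<delta> \<longleftrightarrow> holds M ys \<delta>) \<longrightarrow> holds M xs \<phi> \<longrightarrow> holds M ys \<phi>)"
  (is "\<exists>D. finite D \<and> D \<subseteq> \<Delta> \<and> ?P D")
proof (rule ccontr)
  assume "\<not> ?thesis"
  then have no: "\<not> ?P D" if "finite D" "D \<subseteq> \<Delta>" for D
    using that by (simp only: not_ex de_Morgan_conj) metis
  let ?r = "rename (\<lambda>i. i + n)"
  \<comment> \<open>This is the biconditional of \<open>\<delta>\<close> at the first tuple and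
    \<open>\<delta>\<close> at the second.\<close>
  let ?i = "\<lambda>\<delta>. Conj (Neg (Conj \<delta> (Neg (?r \<delta>)))) (Neg (Conj (Neg \<delta>) (?r \<delta>)))"
  let ?\<Phi> = "{\<phi>, Neg (?r \<phi>)} \<union> ?i ` \<Delta>"
  have fst: "holds M (xs @ ys) \<delta> = holds M xs \<delta>"
    and snd: "holds M (xs @ ys) (?r \<delta>) = holds M ys \<delta>"
    if "\<delta> \<in> formulas L n" "length xs = n" "length ys = n" for \<delta> xs ys
    using that holds_append[of \<delta> L xs] holds_rename[of \<delta> L ys "xs @ ys"] by (auto simp: nth_append)
  have r: "?r \<delta> \<in> formulas L (n + n)" "\<delta> \<in> formulas L (n + n)" if "\<delta> \<in> formulas L n" for \<delta>
    using that by (auto intro: rename_in_formulas formulas_mono)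
  have "\<exists>zs. length zs = n + n \<and> set zs \<subseteq> U \<and> (\<forall>\<psi>\<in>?\<Phi>. holds M zs \<psi>)"
  proof (rule realize_tuple)
    show "?\<Phi> \<subseteq> formulas L (n + n)" using \<phi> \<Delta> r by auto
    fix \<Psi> assume \<Psi>: "\<Psi> \<subseteq> ?\<Phi>" "finite \<Psi>"
    then obtain D where D: "finite D" "D \<subseteq> \<Delta>" "\<Psi> \<inter> ?i ` \<Delta> = ?i ` D"
      using finite_subset_image[of "\<Psi> \<inter> ?i ` \<Delta>" ?i \<Delta>] by auto
    then obtain xs ys where xy: "length xs = n" "length ys = n" "set xs \<subseteq> U" "set ys \<subseteq> U"
      "\<forall>\<delta>\<in>D. holds M xs \<delta> \<longleftrightarrow> holds M ys \<delta>" "holds M xs \<phi>" "\<not> holds M ys \<phi>"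
      using no[OF D(1,2)] by (simp only: not_all not_imp) blast
    have "\<Psi> \<subseteq> {\<phi>, Neg (?r \<phi>)} \<union> ?i ` D" using \<Psi>(1) D(3) by blast
    moreover have "holds M (xs @ ys) (?i \<delta>)" if "\<delta> \<in> D" for \<delta>
    proof -
      have "\<delta> \<in> formulas L n" using that D(2) \<Delta> by blast
      then show ?thesis using xy(5) that by (simp add: fst[OF _ xy(1,2)] snd[OF _ xy(1,2)])
    qed
    then have "holds M (xs @ ys) \<psi>" if "\<psi> \<in> {\<phi>, Neg (?r \<phi>)} \<union> ?i ` D" for \<psi>
      using that xy(6,7) fst[OF \<phi> xy(1,2)] snd[OF \<phi> xy(1,2)] by auto
    ultimately have "\<forall>\<psi>\<in>\<Psi>. holds M (xs @ ys) \<psi>" by blast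
    then show "\<exists>zs. length zs = n + n \<and> set zs \<subseteq> U \<and> (\<forall>\<psi>\<in>\<Psi>. holds M zs \<psi>)"
      using xy(1-4) by (intro exI[of _ "xs @ ys"]) auto
  qed
  then obtain zs where zs: "length zs = n + n" "set zs \<subseteq> U" "\<forall>\<psi>\<in>?\<Phi>. holds M zs \<psi>" by blast
  define xs where "xs = take n zs"
  define ys where "ys = drop n zs"
  have xy: "zs = xs @ ys" "length xs = n" "length ys = n" "set xs \<subseteq> U" "set ys \<subseteq> U"
    using zs by (auto simp: xs_def ys_def dest: in_set_takeD in_set_dropD)
  have "holds M xs \<delta> \<longleftrightarrow> holds M ys \<delta>" if "\<delta> \<in> \<Delta>" for \<delta>
  proof -
    have "holds M zs (?i \<delta>)" "\<delta> \<in> formulas L n" using zs(3) that \<Delta> by blast+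
    then show ?thesis
      unfolding xy(1) by (auto simp: fst[OF _ xy(2,3)] snd[OF _ xy(2,3)])
  qed
  moreover have "holds M zs \<phi>" "holds M zs (Neg (?r \<phi>))" using zs(3) by blast+
  then have "holds M xs \<phi>" "\<not> holds M ys \<phi>"
    unfolding xy(1) by (auto simp: fst[OF \<phi> xy(2,3)] snd[OF \<phi> xy(2,3)])
  ultimately show False using sep[of xs ys] xy by blast
qed

text \<open>Each color is named by its own extension. The empty set names the order at arity 2 and
  may also occur as a color; arities keep the two symbols apart.\<close>

definition color_lang :: "(unit, 'a set) lang" where
  "color_lang = \<lparr>funs = {},
    rels = insert ({}, 2) ((\<lambda>\<theta>. ({x \<in> U. holds M [x] \<theta>}, 1)) ` formulas L 1)\<rparr>"

text \<open>The same name can stand for a color and for the order, so the interpretation decides by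
  the length of the argument list.\<close>

definition color_struct :: "(unit, 'a set, 'a) struct" where
  "color_struct = \<lparr>universe = U, fnI = \<lambda>_ _. undefined,
    relI = \<lambda>P xs. if length xs = 1 then hd xs \<in> P else hd xs \<sqsubset> hd (tl xs)\<rparr>"

lemma color_struct_simps [simp]:
  "universe color_struct = U" "relI color_struct P [x] \<longleftrightarrow> x \<in> P"
  "less_in P color_struct = less_in lt M"
  by (simp_all add: color_struct_def less_in_def fun_eq_iff)

lemma colored_order_color_struct: "colored_order color_lang {} color_struct"
proof -
  show ?thesis
    unfolding colored_order_def linearly_ordered_def color_struct_simps
    using linear by (auto simp: linearly_ordered_def is_struct_def color_lang_def)
qed

lemma color_translate:
  assumes "\<psi> \<in> formulas color_lang n"
  shows "\<exists>\<phi>\<in>formulas L n. \<forall>xs. length xs = n \<longrightarrow> set xs \<subseteq> U \<longrightarrow>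
    (holds M xs \<phi> \<longleftrightarrow> holds color_struct xs \<psi>)"
  using colored_order_color_struct assms
proof (induction rule: colored_fm_induct)
  case (Eq n i j)
  then show ?case by (intro bexI[of _ "Eq (Var i) (Var j)"]) auto
next
  case (less n i j)
  then show ?case using lt_in_rels by (intro bexI[of _ "Rel lt [Var i, Var j]"]) auto
next
  case (color n P i)
  then obtain \<theta> where \<theta>: "\<theta> \<in> formulas L 1" "P = {x \<in> U. holds M [x] \<theta>}"
    by (auto simp: color_lang_def)
  let ?\<phi> = "rename (\<lambda>_. i) \<theta>"
  have "holds M xs ?\<phi> \<longleftrightarrow> holds M [xs ! i] \<theta>" for xs
    using \<theta>(1) by (intro holds_rename[of _ L]) auto
  moreover have "?\<phi> \<in> formulas L n" using \<theta>(1) color by (auto intro: rename_in_formulas)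
  ultimately show ?case using \<theta>(2) color by (intro bexI[of _ ?\<phi>]) auto
next
  case (Neg n \<psi>)
  then obtain \<phi> where "\<phi> \<in> formulas L n" "\<forall>xs. length xs = n \<longrightarrow> set xs \<subseteq> U \<longrightarrow>
    (holds M xs \<phi> \<longleftrightarrow> holds color_struct xs \<psi>)" by blast
  then show ?case by (intro bexI[of _ "Neg \<phi>"]) auto
next
  case (Conj n \<psi> \<chi>)
  then obtain \<phi> \<phi>' where "\<phi> \<in> formulas L n" "\<phi>' \<in> formulas L n"
    "\<forall>xs. length xs = n \<longrightarrow> set xs \<subseteq> U \<longrightarrow> (holds M xs \<phi> \<longleftrightarrow> holds color_struct xs \<psi>)"
    "\<forall>xs. length xs = n \<longrightarrow> set xs \<subseteq> U \<longrightarrow> (holds M xs \<phi>' \<longleftrightarrow> holds color_struct xs \<chi>)"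
    by blast
  then show ?case by (intro bexI[of _ "Conj \<phi> \<phi>'"]) auto
next
  case (Exi n \<psi>)
  then obtain \<phi> where "\<phi> \<in> formulas L (Suc n)" "\<forall>xs. length xs = Suc n \<longrightarrow> set xs \<subseteq> U \<longrightarrow>
    (holds M xs \<phi> \<longleftrightarrow> holds color_struct xs \<psi>)" by blast
  then show ?case by (intro bexI[of _ "Exi \<phi>"]) auto
qed

text \<open>A unary formula of \<open>L\<close> becomes an atom of the colored language. Replacing
  the entries of a sequence by such atoms turns \<open>btw\<close> into a colored formula expressing
  that the sequence is realized.\<close>

lemma match_of_color_equiv:
  assumes len: "length xs = n" "length ys = n" and U: "set xs \<subseteq> U" "set ys \<subseteq> U"
    and eq: "\<And>\<psi>. \<psi> \<in> formulas color_lang n \<Longrightarrow>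
      holds color_struct xs \<psi> \<longleftrightarrow> holds color_struct ys \<psi>"
  shows "match xs ys"
  unfolding match_def
proof (intro conjI allI impI)
  show "length xs = length ys" "set xs \<subseteq> U" "set ys \<subseteq> U" using len U by auto
next
  fix i assume i: "i < length xs"
  show "tp L M [xs ! i] = tp L M [ys ! i]"
  proof (rule tp_eqI)
    fix \<theta> assume "\<theta> \<in> formulas L (length [xs ! i])"
    then have "Rel {x \<in> U. holds M [x] \<theta>} [Var i] \<in> formulas color_lang n"
      using i len by (auto simp: color_lang_def)
    from eq[OF this] show "holds M [xs ! i] \<theta> = holds M [ys ! i] \<theta>"
      using i len U by (auto simp: subset_iff)
  qed simp
next
  fix i j assume ij: "i < length xs" "j < length xs"
  show "S (xs ! i) (xs ! j) = S (ys ! i) (ys ! j)"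
    unfolding rseqs_eq_iff
  proof (intro allI impI)
    fix \<phi>s assume \<phi>s: "set \<phi>s \<subseteq> formulas L 1"
    \<comment> \<open>On \<open>U\<close> this atom is equivalent to \<open>\<theta>\<close>, which
      is enough because all points between the endpoints lie in \<open>U\<close>.\<close>
    let ?col = "\<lambda>\<theta>. Rel {x \<in> U. holds M [x] \<theta>} [Var 0] :: (unit, 'a set) fm"
    let ?b = "btw {} (map ?col \<phi>s)"
    have tr: "transp_on (universe color_struct) (less_in {} color_struct)"
      and rl: "({}, 2) \<in> rels color_lang"
      using colored_order_color_struct by (auto simp: colored_order_def linearly_ordered_def)
    have col: "set (map ?col \<phi>s) \<subseteq> formulas color_lang 1"
      using \<phi>s by (auto simp: color_lang_def)
    have b: "?b \<in> formulas color_lang 2"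
      by (rule btw_in_formulas[OF rl col])
    have inc: "increasing {} color_struct zs = increasing lt M zs" for zs
      by (simp add: increasing_def)
    have rb: "realized_between {} color_struct x y (map ?col \<phi>s) = realized_between lt M x y \<phi>s" for x y
      unfolding realized_between_def inc
      by (auto simp: increasing_def list_all2_conv_all_nth subset_iff)
    let ?b' = "rename (case_nat i (\<lambda>_. j)) ?b"
    have h: "holds color_struct zs ?b' \<longleftrightarrow> realized_between lt M (zs ! i) (zs ! j) \<phi>s"
      if "length zs = n" "set zs \<subseteq> U" for zs
    proof -
      have "holds color_struct zs ?b' = holds color_struct [zs ! i, zs ! j] ?b"
        using b by (intro holds_rename[of _ color_lang]) (auto simp: less_Suc_eq numeral_2_eq_2)
      also have "\<dots> = realized_between {} color_struct (zs ! i) (zs ! j) (map ?col \<phi>s)"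
        using that ij len by (intro holds_btw[OF tr rl col]) auto
      finally show ?thesis by (simp add: rb)
    qed
    have "?b' \<in> formulas color_lang n"
      using ij len by (intro rename_in_formulas[OF b]) (auto split: nat.split)
    from eq[OF this] show "realized_between lt M (xs ! i) (xs ! j) \<phi>s =
        realized_between lt M (ys ! i) (ys ! j) \<phi>s"
      using h len U by simp
  qed
qed

text \<open>The translation of colored formulas into \<open>L\<close> lets compactness be applied in
  \<open>M\<close>, where saturation is available. The finite separating set found there is pulled
  back to colored formulas, and \<open>definable_of_invariant\<close> combines these into a
  definition.\<close>

lemma definitionally_equivalent_color_struct:
  assumes m: "\<And>as bs. match as bs \<Longrightarrow> tp L M as = tp L M bs"
  shows "definitionally_equivalent L M color_lang color_struct"
  unfolding definitionally_equivalent_def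
proof (intro conjI allI iffI)
  fix n X assume "definable L M n X"
  then obtain \<phi> where \<phi>: "\<phi> \<in> formulas L n"
    and X: "X = {xs. length xs = n \<and> set xs \<subseteq> U \<and> holds M xs \<phi>}"
    by (auto simp: definable_def)
  obtain t where t: "\<And>\<psi>. \<psi> \<in> formulas color_lang n \<Longrightarrow> t \<psi> \<in> formulas L n"
    "\<And>\<psi> xs. \<psi> \<in> formulas color_lang n \<Longrightarrow> length xs = n \<Longrightarrow> set xs \<subseteq> U \<Longrightarrow>
      holds M xs (t \<psi>) \<longleftrightarrow> holds color_struct xs \<psi>"
    using color_translate[of _ n] by metis
  have "\<exists>D. finite D \<and> D \<subseteq> t ` formulas color_lang n \<and>
    (\<forall>xs ys. length xs = n \<longrightarrow> length ys = n \<longrightarrow> set xs \<subseteq> U \<longrightarrow> set ys \<subseteq> U \<longrightarrow>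
      (\<forall>\<delta>\<in>D. holds M xs \<delta> \<longleftrightarrow> holds M ys \<delta>) \<longrightarrow> holds M xs \<phi> \<longrightarrow> holds M ys \<phi>)"
  proof (rule finite_separation[OF \<phi>])
    show "t ` formulas color_lang n \<subseteq> formulas L n" using t(1) by blast
    fix xs ys assume *: "length xs = n" "length ys = n" "set xs \<subseteq> U" "set ys \<subseteq> U"
      "\<And>\<delta>. \<delta> \<in> t ` formulas color_lang n \<Longrightarrow> holds M xs \<delta> \<longleftrightarrow> holds M ys \<delta>" "holds M xs \<phi>"
    have "match xs ys"
    proof (rule match_of_color_equiv[OF *(1-4)])
      fix \<psi> assume "\<psi> \<in> formulas color_lang n"
      then show "holds color_struct xs \<psi> \<longleftrightarrow> holds color_struct ys \<psi>"
        using *(5)[of "t \<psi>"] t(2)[of \<psi>] *(1-4) by blast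
    qed
    from tp_eqD[OF m[OF this]] show "holds M ys \<phi>" using *(1,2,6) \<phi> by simp
  qed
  then obtain \<Delta> where \<Delta>: "finite \<Delta>" "\<Delta> \<subseteq> t ` formulas color_lang n"
    and sep: "\<And>xs ys. length xs = n \<Longrightarrow> length ys = n \<Longrightarrow> set xs \<subseteq> U \<Longrightarrow> set ys \<subseteq> U \<Longrightarrow>
      \<forall>\<delta>\<in>\<Delta>. holds M xs \<delta> \<longleftrightarrow> holds M ys \<delta> \<Longrightarrow> holds M xs \<phi> \<Longrightarrow> holds M ys \<phi>"
    by blast
  obtain G where G: "finite G" "G \<subseteq> formulas color_lang n" "\<Delta> = t ` G"
    using finite_subset_image[OF \<Delta>] by blast
  show "definable color_lang color_struct n X"
  proof (rule definable_of_invariant[OF G(1,2)])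
    show "X \<subseteq> {xs. length xs = n \<and> set xs \<subseteq> universe color_struct}" by (auto simp: X)
    fix xs ys assume *: "xs \<in> X" "length ys = n" "set ys \<subseteq> universe color_struct"
      "\<And>\<psi>. \<psi> \<in> G \<Longrightarrow> holds color_struct xs \<psi> \<longleftrightarrow> holds color_struct ys \<psi>"
    have "holds M xs \<delta> \<longleftrightarrow> holds M ys \<delta>" if "\<delta> \<in> \<Delta>" for \<delta>
      using that * G(2,3) t(2) unfolding X by auto
    then show "ys \<in> X" using * sep[of xs ys] by (simp add: X)
  qed
next
  fix n X assume "definable color_lang color_struct n X"
  then obtain \<psi> where \<psi>: "\<psi> \<in> formulas color_lang n"
    and X: "X = {xs. length xs = n \<and> set xs \<subseteq> U \<and> holds color_struct xs \<psi>}"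
    by (auto simp: definable_def)
  obtain \<phi> where "\<phi> \<in> formulas L n" "\<forall>xs. length xs = n \<longrightarrow> set xs \<subseteq> U \<longrightarrow>
      (holds M xs \<phi> \<longleftrightarrow> holds color_struct xs \<psi>)"
    using color_translate[OF \<psi>] by blast
  then show "definable L M n X" unfolding definable_def X by (intro bexI[of _ \<phi>]) auto
qed simp

end

theorem theorem2p1:
  fixes L :: "('f, 'r) lang" and lt :: 'r and M :: "('f, 'r, 'a) struct"
  assumes "linearly_ordered L lt M"
    and "omega_saturated L M"
    and "{\<phi>. wf_fm L \<phi>} \<lesssim> (UNIV :: 'u set)"
  shows "RB TYPE('u) L lt M \<longleftrightarrow> def_equiv_to_colored_order L lt M"
proof -
  interpret saturated_linear_struct L lt M
    by unfold_locales (rule assms)+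
  show ?thesis
  proof
    assume "RB TYPE('u) L lt M"
    then have "tp L M as = tp L M bs" if "match as bs" for as bs
      using match_imp_tp_eq[OF tp_eq_of_RB[OF _ assms(3)]] that by blast
    then have "definitionally_equivalent L M color_lang color_struct"
      by (rule definitionally_equivalent_color_struct)
    with colored_order_color_struct show "def_equiv_to_colored_order L lt M"
      unfolding def_equiv_to_colored_order_def
      by (intro exI[of _ color_lang] exI[of _ "{}"] exI[of _ color_struct]) simp
  next
    assume "def_equiv_to_colored_order L lt M"
    then obtain K :: "(unit, 'a set) lang" and lt' and C :: "(unit, 'a set, 'a) struct"
      where "colored_order K lt' C"
        "\<And>x y. x \<in> U \<Longrightarrow> y \<in> U \<Longrightarrow> less_in lt' C x y \<longleftrightarrow> less_in lt M x y"
        "definitionally_equivalent L M K C"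
      unfolding def_equiv_to_colored_order_def by blast
    then show "RB TYPE('u) L lt M"
      by (intro RB_of_match match_imp_tp_eq_of_equiv[of K lt' C])
  qed
qed

end
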